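(* The mixing time $t_{mix}(\varepsilon)$ for the Hadamard quantum walk on the $n$-cycle satisfies the following inequalities: $$\frac{c_1}{\varepsilon}n^2\le t_{mix}(\varepsilon)\le\frac{c_2}{\varepsilon}n^2\log(n),$$ where $c_1$ and $c_2$ are positive constants.
   Context: Hadamard quantum walk on the $n$-cycle: let $V=\mathbb{Z}_n$ and $S=\{1,2\}$; each vertex $v$ has labelled neighbours $v_1=v+1$, $v_2=v-1$ (labelling by the generator of $\mathbb{Z}_n$ and its inverse). The coin is $$C=\frac{1}{\sqrt2}\begin{pmatrix}1&1\\-1&1\end{pmatrix}.$$ The walk operator $U$ is the unitary operator on $L^2_{\mathbb{C}}(V\times S)$ sending the basis vector $\delta_{(v,s)}$ to $\sum_{s'\in S}C_{s's}\,\delta_{(v_s,s')}$. Mixing time: for $\psi\in L^2_{\mathbb{C}}(V\times S)$ with $\|\psi\|=1$ let $\psi_t=U^t\psi$, let $$p(x)=\lim_{T\to\infty}\frac1T\sum_{t=0}^{T-1}|\psi_t(x)|^2$$ (the limit exists and may depend on $\psi$), and for $T=1,2,\dots$ let $$d(T,\psi)=\sum_{x\in V\times S}\left|\frac1T\sum_{t=0}^{T-1}|\psi_t(x)|^2-p(x)\right|.$$ Then $$t_{mix}(\varepsilon)=\sup_{\psi}\ \inf\{T: d(T',\psi)\le\varepsilon \text{ for all } T'\ge T\},$$ the supremum being over all $\psi$ with $\|\psi\|=1$.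
   Formalization: The claim is proved for n ≥ 3 and 0 < ε < 1 with absolute constants c_1, c_2; for unrestricted ε it fails, since d ≤ 2 always gives t_mix(ε) = 1 for ε ≥ 2, contradicting the lower bound for large n. *)

theory Defs
  imports Complex_Main "HOL-Library.Extended_Real"
begin

text \<open>
  Elements of the complex \<open>L\<^sup>2\<close> space over a finite set \<open>X\<close> are functions vanishing outside \<open>X\<close>;
  evolution operators are arbitrary maps on such functions.
\<close>

definition L2 :: "'a set \<Rightarrow> ('a \<Rightarrow> complex) set" where
  "L2 X = {\<psi>. \<forall>x. x \<notin> X \<longrightarrow> \<psi> x = 0}"

definition L2_norm :: "'a set \<Rightarrow> ('a \<Rightarrow> complex) \<Rightarrow> real" where
  "L2_norm X \<psi> = sqrt (\<Sum>x\<in>X. (cmod (\<psi> x))\<^sup>2)"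

definition delta :: "'a \<Rightarrow> 'a \<Rightarrow> complex" where
  "delta x = (\<lambda>y. if y = x then 1 else 0)"

definition time_avg :: "(('a \<Rightarrow> complex) \<Rightarrow> ('a \<Rightarrow> complex)) \<Rightarrow> ('a \<Rightarrow> complex) \<Rightarrow> nat \<Rightarrow> 'a \<Rightarrow> real" where
  "time_avg U \<psi> T x = 1 / real T * (\<Sum>t<T. (cmod ((U ^^ t) \<psi> x))\<^sup>2)"

definition limit_dist :: "(('a \<Rightarrow> complex) \<Rightarrow> ('a \<Rightarrow> complex)) \<Rightarrow> ('a \<Rightarrow> complex) \<Rightarrow> 'a \<Rightarrow> real" where
  "limit_dist U \<psi> x = lim (\<lambda>T. time_avg U \<psi> T x)"

definition mix_dist ::
    "'a set \<Rightarrow> (('a \<Rightarrow> complex) \<Rightarrow> ('a \<Rightarrow> complex)) \<Rightarrow> nat \<Rightarrow> ('a \<Rightarrow> complex) \<Rightarrow> real" where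
  "mix_dist X U T \<psi> = (\<Sum>x\<in>X. \<bar>time_avg U \<psi> T x - limit_dist U \<psi> x\<bar>)"

text \<open>
  The mixing time is extended-real valued, so that the supremum over all unit vectors and the
  infimum have their true values without any boundedness or nonemptiness assumption.
\<close>

definition mixing_time ::
    "'a set \<Rightarrow> (('a \<Rightarrow> complex) \<Rightarrow> ('a \<Rightarrow> complex)) \<Rightarrow> real \<Rightarrow> ereal" where
  "mixing_time X U \<epsilon> =
     (SUP \<psi> \<in> {\<psi> \<in> L2 X. L2_norm X \<psi> = 1}.
        INF T \<in> {T::nat. 1 \<le> T \<and> (\<forall>T'\<ge>T. mix_dist X U T' \<psi> \<le> \<epsilon>)}. ereal (real T))"

text \<open>The cyclic group of order \<open>n\<close> is represented by the residues \<open>0, \<dots>, n - 1\<close>.\<close>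

definition cycle_states :: "nat \<Rightarrow> (int \<times> nat) set" where
  "cycle_states n = {0..<int n} \<times> {1, 2}"

definition cycle_nbr :: "nat \<Rightarrow> int \<Rightarrow> nat \<Rightarrow> int" where
  "cycle_nbr n v s = (if s = 1 then v + 1 else v - 1) mod int n"

text \<open>\<open>hadamard_coin i j\<close> is the entry in row \<open>i\<close> and column \<open>j\<close>, for \<open>i, j \<in> {1, 2}\<close>.\<close>

definition hadamard_coin :: "nat \<Rightarrow> nat \<Rightarrow> complex" where
  "hadamard_coin i j = complex_of_real (1 / sqrt 2) * (if i = 2 \<and> j = 1 then - 1 else 1)"

text \<open>
  The linear extension of
  \<open>\<delta>\<^bsub>(v,s)\<^esub> \<mapsto> \<Sum>s'\<in>{1,2}. C\<^bsub>s's\<^esub> \<delta>\<^bsub>(v\<^sub>s,s')\<^esub>\<close>.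
\<close>

definition hadamard_walk :: "nat \<Rightarrow> (int \<times> nat \<Rightarrow> complex) \<Rightarrow> (int \<times> nat \<Rightarrow> complex)" where
  "hadamard_walk n \<psi> =
     (\<lambda>y. \<Sum>(v, s)\<in>cycle_states n.
        \<psi> (v, s) * (\<Sum>s'\<in>{1, 2}. hadamard_coin s' s * delta (cycle_nbr n v s, s') y))"

end

theory Submission
  imports Defs
begin

text \<open>
  On the Fourier mode of angle \<open>\<theta> = 2 * pi * k / n\<close> the walk acts as a unitary
  \<open>2 \<times> 2\<close> matrix of determinant \<open>1\<close> and trace \<open>sqrt 2 * cos \<theta>\<close>, so its eigenvalues have
  real part \<open>cos \<theta> / sqrt 2\<close>. For a unit vector with eigencomponents \<open>\<phi> i\<close> to the distinct
  eigenvalues \<open>\<mu> i\<close>, the time average differs from its limit by the off-diagonal terms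
  \<open>\<phi> i * cnj (\<phi> j)\<close>, weighted by the mean of the first \<open>T\<close> powers of \<open>\<mu> i * cnj (\<mu> j)\<close>, which is at most
  \<open>2 / (T * cmod (\<mu> i - \<mu> j))\<close>. A Schur test reduces the upper bound to
  \<open>\<Sum>j\<noteq>i. 1 / cmod (\<mu> i - \<mu> j) = O(n\<^sup>2)\<close>; this even gives \<open>t\<^sub>m\<^sub>i\<^sub>x(\<epsilon>) = O(n\<^sup>2 / \<epsilon>)\<close>.

  For the lower bound with small \<open>\<epsilon>\<close>, superpose the modes \<open>k = 0\<close> and \<open>k = 1\<close>: their eigenvalues are
  \<open>O(1 / n\<^sup>2)\<close> apart, and the resulting beat is averaged out only at rate \<open>n\<^sup>2 / T\<close>. For \<open>\<epsilon>\<close> bounded away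
  from \<open>0\<close>, a packet of the modes \<open>0, \<dots>, 7\<close> stays concentrated for a time of order \<open>n\<^sup>2\<close>, although its
  limit distribution is uniform along the cycle; the distance of the two exceeds \<open>1\<close>.
\<close>

section \<open>Time averages of superpositions of eigenvectors\<close>

definition power_mean :: "nat \<Rightarrow> complex \<Rightarrow> complex" where
  "power_mean T z = (\<Sum>t<T. z ^ t) / of_nat T"

lemma power_mean_eq:
  assumes "z \<noteq> 1"
  shows "power_mean T z = (1 - z ^ T) / ((1 - z) * of_nat T)"
proof -
  have "(z ^ T - 1) / (z - 1) = (1 - z ^ T) / (1 - z)"
    by (metis minus_diff_eq minus_divide_divide)
  then show ?thesis
    using assms by (simp add: power_mean_def geometric_sum)
qed

text \<open>The geometric sum has a numerator of modulus at most 2, so the mean decays like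
  \<open>1 / T\<close>, the more slowly the closer \<open>z\<close> is to 1.\<close>

lemma norm_power_mean_le:
  assumes "cmod z = 1" "z \<noteq> 1"
  shows "cmod (power_mean T z) \<le> 2 / (real T * cmod (1 - z))"
proof -
  have "cmod (1 - z ^ T) \<le> 2"
    using norm_triangle_ineq4[of 1 "z ^ T"] assms by (simp add: norm_power)
  then show ?thesis
    by (simp add: power_mean_eq[OF assms(2)] norm_divide norm_mult divide_right_mono mult.commute)
qed

lemma power_mean_tendsto_0:
  assumes "cmod z = 1" "z \<noteq> 1"
  shows "(\<lambda>T. power_mean T z) \<longlonglongrightarrow> 0"
proof -
  have bound: "\<forall>\<^sub>F T in sequentially. cmod (power_mean T z) \<le> 2 / cmod (1 - z) * inverse (real T)"
    using norm_power_mean_le[OF assms] by (simp add: field_simps)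
  have lim: "(\<lambda>T. 2 / cmod (1 - z) * inverse (real T)) \<longlonglongrightarrow> 0"
    by (rule tendsto_mult_right_zero[OF lim_inverse_n])
  have "(\<lambda>T. cmod (power_mean T z)) \<longlonglongrightarrow> 0"
    by (rule real_tendsto_sandwich[OF _ bound tendsto_const lim]) simp
  then show ?thesis by (rule tendsto_norm_zero_cancel)
qed

lemma norm_one_minus_power_le:
  assumes "cmod z = 1"
  shows "cmod (1 - z ^ t) \<le> real t * cmod (1 - z)"
  using norm_power_diff[of 1 z t] assms by simp

text \<open>The opposite regime: while \<open>T\<close> is small against
  \<open>1 / cmod (1 - z)\<close>, the powers have hardly left 1. This keeps a packet together in
  the lower bound.\<close>

lemma norm_power_mean_minus_one_le:
  assumes "cmod z = 1" "T > 0"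
  shows "cmod (power_mean T z - 1) \<le> real T * cmod (1 - z)"
proof -
  have "power_mean T z - 1 = (\<Sum>t<T. z ^ t - 1) / of_nat T"
    using assms(2) by (simp add: power_mean_def sum_subtractf field_simps)
  also have "cmod \<dots> \<le> (\<Sum>t<T. cmod (z ^ t - 1)) / T"
    by (simp add: norm_divide divide_right_mono norm_sum)
  also have "\<dots> \<le> (\<Sum>t<T. real T * cmod (1 - z)) / T"
  proof (intro divide_right_mono sum_mono)
    fix t assume "t \<in> {..<T}"
    then have "real t * cmod (1 - z) \<le> real T * cmod (1 - z)"
      by (intro mult_right_mono) auto
    then show "cmod (z ^ t - 1) \<le> real T * cmod (1 - z)"
      using norm_one_minus_power_le[OF assms(1), of t] by (simp add: norm_minus_commute)
  qed simp
  finally show ?thesis using assms(2) by simp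
qed

lemma norm_power_mean_le_one:
  assumes "cmod z = 1"
  shows "cmod (power_mean T z) \<le> 1"
proof -
  have "cmod (\<Sum>t<T. z ^ t) \<le> real T"
    using norm_sum[of "\<lambda>t. z ^ t" "{..<T}"] assms by (simp add: norm_power)
  then show ?thesis
    by (cases "T = 0") (simp_all add: power_mean_def norm_divide)
qed

section \<open>Vectors expanded in eigenvectors with distinct eigenvalues\<close>

text \<open>The components carry their own normalisation and may be zero, so that any vector can be
  indexed by the whole spectrum. Injectivity makes every off-diagonal ratio
  \<open>\<mu> i * cnj (\<mu> j)\<close> differ from 1.\<close>

locale eigen_expansion =
  fixes X :: "'a set" and U :: "('a \<Rightarrow> complex) \<Rightarrow> ('a \<Rightarrow> complex)"
    and I :: "'i set" and \<mu> :: "'i \<Rightarrow> complex" and \<phi> :: "'i \<Rightarrow> 'a \<Rightarrow> complex"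
  assumes finite_states: "finite X" and finite_index: "finite I"
    and linear: "\<And>c. U (\<lambda>x. \<Sum>i\<in>I. c i * \<phi> i x) = (\<lambda>x. \<Sum>i\<in>I. c i * U (\<phi> i) x)"
    and eigen: "\<And>i. i \<in> I \<Longrightarrow> U (\<phi> i) = (\<lambda>x. \<mu> i * \<phi> i x)"
    and unimodular: "\<And>i. i \<in> I \<Longrightarrow> cmod (\<mu> i) = 1"
    and inj: "inj_on \<mu> I"
begin

definition \<psi> :: "'a \<Rightarrow> complex" where
  "\<psi> = (\<lambda>x. \<Sum>i\<in>I. \<phi> i x)"

lemma iterate: "(U ^^ t) \<psi> = (\<lambda>x. \<Sum>i\<in>I. \<mu> i ^ t * \<phi> i x)"
proof (induction t)
  case 0
  show ?case by (simp add: \<psi>_def)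
next
  case (Suc t)
  have "(U ^^ Suc t) \<psi> = (\<lambda>x. \<Sum>i\<in>I. \<mu> i ^ t * U (\<phi> i) x)"
    by (simp add: Suc linear)
  also have "\<dots> = (\<lambda>x. \<Sum>i\<in>I. \<mu> i ^ Suc t * \<phi> i x)"
    by (intro ext sum.cong) (simp_all add: eigen)
  finally show ?case .
qed

lemma ratio_norm: "i \<in> I \<Longrightarrow> j \<in> I \<Longrightarrow> cmod (\<mu> i * cnj (\<mu> j)) = 1"
  by (simp add: norm_mult unimodular)

lemma mult_cnj_self: "i \<in> I \<Longrightarrow> \<mu> i * cnj (\<mu> i) = 1"
  using unimodular[of i] by (metis complex_norm_square of_real_1 power_one)

lemma one_minus_ratio_norm:
  assumes "i \<in> I" "j \<in> I"
  shows "cmod (1 - \<mu> i * cnj (\<mu> j)) = cmod (\<mu> i - \<mu> j)"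
proof -
  have "1 - \<mu> i * cnj (\<mu> j) = (\<mu> j - \<mu> i) * cnj (\<mu> j)"
    using mult_cnj_self[OF assms(2)] by (simp add: algebra_simps)
  then show ?thesis
    using assms by (simp add: norm_mult unimodular norm_minus_commute)
qed

lemma ratio_neq_one: "i \<in> I \<Longrightarrow> j \<in> I \<Longrightarrow> i \<noteq> j \<Longrightarrow> \<mu> i * cnj (\<mu> j) \<noteq> 1"
  using one_minus_ratio_norm[of i j] inj by (auto simp: inj_on_def)

lemma time_avg_eq:
  "complex_of_real (time_avg U \<psi> T x) =
     (\<Sum>i\<in>I. \<Sum>j\<in>I. \<phi> i x * cnj (\<phi> j x) * power_mean T (\<mu> i * cnj (\<mu> j)))"
proof -
  have "complex_of_real ((cmod ((U ^^ t) \<psi> x))\<^sup>2) =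
      (\<Sum>i\<in>I. \<Sum>j\<in>I. \<phi> i x * cnj (\<phi> j x) * (\<mu> i * cnj (\<mu> j)) ^ t)" for t
    unfolding complex_norm_square iterate
    by (simp add: sum_product power_mult_distrib algebra_simps)
  then have "complex_of_real (time_avg U \<psi> T x) =
      (\<Sum>t<T. \<Sum>i\<in>I. \<Sum>j\<in>I. \<phi> i x * cnj (\<phi> j x) * (\<mu> i * cnj (\<mu> j)) ^ t) / of_nat T"
    by (simp add: time_avg_def)
  also have "\<dots> = (\<Sum>i\<in>I. \<Sum>j\<in>I. \<Sum>t<T. \<phi> i x * cnj (\<phi> j x) * (\<mu> i * cnj (\<mu> j)) ^ t) / of_nat T"
    by (subst sum.swap, subst (2) sum.swap) simp
  also have "\<dots> = (\<Sum>i\<in>I. \<Sum>j\<in>I. \<phi> i x * cnj (\<phi> j x) * power_mean T (\<mu> i * cnj (\<mu> j)))"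
    by (simp add: power_mean_def sum_divide_distrib sum_distrib_left)
  finally show ?thesis .
qed

text \<open>On the diagonal the ratio of eigenvalues is 1, with power mean 1 for positive
  \<open>T\<close>, so only the off-diagonal terms depend on \<open>T\<close>.\<close>

lemma time_avg_eq_offdiag:
  assumes "T > 0"
  shows "complex_of_real (time_avg U \<psi> T x) = of_real (\<Sum>i\<in>I. (cmod (\<phi> i x))\<^sup>2) +
     (\<Sum>i\<in>I. \<Sum>j\<in>I - {i}. \<phi> i x * cnj (\<phi> j x) * power_mean T (\<mu> i * cnj (\<mu> j)))"
proof -
  have "power_mean T 1 = 1" using assms by (simp add: power_mean_def)
  then have "(\<Sum>j\<in>I. \<phi> i x * cnj (\<phi> j x) * power_mean T (\<mu> i * cnj (\<mu> j))) =
      of_real ((cmod (\<phi> i x))\<^sup>2) +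
      (\<Sum>j\<in>I - {i}. \<phi> i x * cnj (\<phi> j x) * power_mean T (\<mu> i * cnj (\<mu> j)))" if "i \<in> I" for i
    by (subst sum.remove[OF finite_index that])
       (simp add: mult_cnj_self[OF that] complex_norm_square del: of_real_power)
  then show ?thesis
    by (simp add: time_avg_eq sum.distrib)
qed

lemma time_avg_tendsto: "(\<lambda>T. time_avg U \<psi> T x) \<longlonglongrightarrow> (\<Sum>i\<in>I. (cmod (\<phi> i x))\<^sup>2)"
proof -
  have "(\<lambda>T. of_real (\<Sum>i\<in>I. (cmod (\<phi> i x))\<^sup>2) +
     (\<Sum>i\<in>I. \<Sum>j\<in>I - {i}. \<phi> i x * cnj (\<phi> j x) * power_mean T (\<mu> i * cnj (\<mu> j))))
     \<longlonglongrightarrow> of_real (\<Sum>i\<in>I. (cmod (\<phi> i x))\<^sup>2) + (\<Sum>i\<in>I. \<Sum>j\<in>I - {i}. \<phi> i x * cnj (\<phi> j x) * 0)"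
    by (intro tendsto_intros power_mean_tendsto_0 ratio_norm ratio_neq_one) auto
  then have "(\<lambda>T. complex_of_real (time_avg U \<psi> T x)) \<longlonglongrightarrow> of_real (\<Sum>i\<in>I. (cmod (\<phi> i x))\<^sup>2)"
    \<comment> \<open>The off-diagonal formula is available for positive \<open>T\<close>, which
      suffices in the limit.\<close>
    by (subst tendsto_cong[OF eventually_mono[OF eventually_gt_at_top[of 0] time_avg_eq_offdiag]]) simp_all
  then show ?thesis by (simp only: tendsto_of_real_iff)
qed

lemma limit_dist_eq: "limit_dist U \<psi> x = (\<Sum>i\<in>I. (cmod (\<phi> i x))\<^sup>2)"
  unfolding limit_dist_def by (rule limI[OF time_avg_tendsto])

lemma deviation_eq:
  assumes "T > 0"
  shows "complex_of_real (time_avg U \<psi> T x - limit_dist U \<psi> x) =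
     (\<Sum>i\<in>I. \<Sum>j\<in>I - {i}. \<phi> i x * cnj (\<phi> j x) * power_mean T (\<mu> i * cnj (\<mu> j)))"
  using time_avg_eq_offdiag[OF assms, of x] by (simp add: limit_dist_eq)

text \<open>Orthogonality of the components, read off from the limit of the time averages.\<close>

lemma sum_norms_eq:
  assumes isometry: "\<And>f. (\<Sum>x\<in>X. (cmod (U f x))\<^sup>2) = (\<Sum>x\<in>X. (cmod (f x))\<^sup>2)"
  shows "(\<Sum>i\<in>I. \<Sum>x\<in>X. (cmod (\<phi> i x))\<^sup>2) = (\<Sum>x\<in>X. (cmod (\<psi> x))\<^sup>2)"
proof -
  \<comment> \<open>The isometry conserves the total mass, so the averages sum to the initial mass
    for every positive \<open>T\<close>. Comparison with the limit gives the identity.\<close>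
  have iter: "(\<Sum>x\<in>X. (cmod ((U ^^ t) \<psi> x))\<^sup>2) = (\<Sum>x\<in>X. (cmod (\<psi> x))\<^sup>2)" for t
    by (induction t) (simp_all add: isometry)
  have "(\<Sum>x\<in>X. time_avg U \<psi> T x) = (\<Sum>x\<in>X. (cmod (\<psi> x))\<^sup>2)" if "T > 0" for T
  proof -
    have "(\<Sum>x\<in>X. time_avg U \<psi> T x) = 1 / T * (\<Sum>t<T. \<Sum>x\<in>X. (cmod ((U ^^ t) \<psi> x))\<^sup>2)"
      unfolding time_avg_def by (subst sum.swap) (simp add: sum_divide_distrib)
    then show ?thesis using that by (simp add: iter)
  qed
  then have "(\<lambda>T. \<Sum>x\<in>X. time_avg U \<psi> T x) \<longlonglongrightarrow> (\<Sum>x\<in>X. (cmod (\<psi> x))\<^sup>2)"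
    by (intro tendsto_eventually eventually_mono[OF eventually_gt_at_top[of 0]])
  moreover have "(\<lambda>T. \<Sum>x\<in>X. time_avg U \<psi> T x) \<longlonglongrightarrow> (\<Sum>x\<in>X. \<Sum>i\<in>I. (cmod (\<phi> i x))\<^sup>2)"
    by (intro tendsto_sum time_avg_tendsto)
  ultimately show ?thesis
    by (subst sum.swap) (rule LIMSEQ_unique)
qed

text \<open>A Schur test: the arithmetic-geometric inequality splits each product of components, the
  symmetry of the weights collects both halves into row sums bounded by \<open>S\<close>, and the
  squared norms of the components add up to that of \<psi>.\<close>

lemma mix_dist_le:
  assumes T: "T > 0"
    and isometry: "\<And>f. (\<Sum>x\<in>X. (cmod (U f x))\<^sup>2) = (\<Sum>x\<in>X. (cmod (f x))\<^sup>2)"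
    and S: "\<And>i. i \<in> I \<Longrightarrow> (\<Sum>j\<in>I - {i}. 1 / cmod (\<mu> i - \<mu> j)) \<le> S"
  shows "mix_dist X U T \<psi> \<le> 2 * S / T * (\<Sum>x\<in>X. (cmod (\<psi> x))\<^sup>2)"
proof -
  define g where "g i j = 1 / cmod (\<mu> i - \<mu> j)" for i j
  define n where "n i x = (cmod (\<phi> i x))\<^sup>2" for i x
  have g_sym: "g i j = g j i" for i j by (simp add: g_def norm_minus_commute)
  have dev: "\<bar>time_avg U \<psi> T x - limit_dist U \<psi> x\<bar> \<le> (\<Sum>i\<in>I. \<Sum>j\<in>I - {i}. (n i x + n j x) * g i j) / T" for x
  proof -
    have "\<bar>time_avg U \<psi> T x - limit_dist U \<psi> x\<bar> =
        cmod (\<Sum>i\<in>I. \<Sum>j\<in>I - {i}. \<phi> i x * cnj (\<phi> j x) * power_mean T (\<mu> i * cnj (\<mu> j)))"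
      by (metis deviation_eq[OF T] norm_of_real)
    also have "\<dots> \<le> (\<Sum>i\<in>I. \<Sum>j\<in>I - {i}. cmod (\<phi> i x * cnj (\<phi> j x) * power_mean T (\<mu> i * cnj (\<mu> j))))"
      by (intro sum_norm_le) auto
    also have "\<dots> \<le> (\<Sum>i\<in>I. \<Sum>j\<in>I - {i}. (n i x + n j x) * g i j / T)"
    proof (intro sum_mono)
      fix i j assume ij: "i \<in> I" "j \<in> I - {i}"
      have "cmod (power_mean T (\<mu> i * cnj (\<mu> j))) \<le> 2 * g i j / T"
        using norm_power_mean_le[OF ratio_norm ratio_neq_one, of i j T] ij
        by (auto simp: one_minus_ratio_norm g_def mult.commute)
      moreover have "cmod (\<phi> i x) * cmod (\<phi> j x) \<le> (n i x + n j x) / 2"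
        using sum_squares_bound[of "cmod (\<phi> i x)" "cmod (\<phi> j x)"] by (simp add: n_def)
      ultimately have "cmod (\<phi> i x) * cmod (\<phi> j x) * cmod (power_mean T (\<mu> i * cnj (\<mu> j)))
          \<le> (n i x + n j x) / 2 * (2 * g i j / T)"
        by (intro mult_mono) (auto simp: n_def)
      then show "cmod (\<phi> i x * cnj (\<phi> j x) * power_mean T (\<mu> i * cnj (\<mu> j))) \<le> (n i x + n j x) * g i j / T"
        by (simp add: norm_mult)
    qed
    finally show ?thesis by (simp add: sum_divide_distrib)
  qed
  \<comment> \<open>After exchanging \<open>i\<close> and \<open>j\<close> the two halves coincide;
    this produces the factor 2 in the bound.\<close>
  have swap: "(\<Sum>i\<in>I. \<Sum>j\<in>I - {i}. n j x * g i j) = (\<Sum>i\<in>I. \<Sum>j\<in>I - {i}. n i x * g i j)" for x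
  proof -
    have "(\<Sum>i\<in>I. \<Sum>j\<in>I - {i}. n j x * g i j) = (\<Sum>j\<in>I. \<Sum>i\<in>I - {j}. n j x * g i j)"
      using finite_index sum.swap_restrict[of I I "\<lambda>i j. n j x * g i j" "\<lambda>i j. j \<noteq> i"]
      by (simp add: set_diff_eq conj_commute eq_commute)
    then show ?thesis by (simp add: g_sym)
  qed
  have "mix_dist X U T \<psi> \<le> (\<Sum>x\<in>X. (\<Sum>i\<in>I. \<Sum>j\<in>I - {i}. (n i x + n j x) * g i j) / T)"
    unfolding mix_dist_def by (intro sum_mono dev)
  also have "\<dots> = (\<Sum>x\<in>X. 2 * (\<Sum>i\<in>I. n i x * (\<Sum>j\<in>I - {i}. g i j)) / T)"
    by (simp add: distrib_right sum.distrib swap sum_distrib_left)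
  also have "\<dots> \<le> (\<Sum>x\<in>X. 2 * (\<Sum>i\<in>I. n i x * S) / T)"
    using S by (intro sum_mono divide_right_mono mult_left_mono) (auto simp: n_def g_def)
  also have "\<dots> = 2 * S / T * (\<Sum>x\<in>X. \<Sum>i\<in>I. n i x)"
    by (simp add: sum_distrib_left sum_distrib_right algebra_simps)
  also have "(\<Sum>x\<in>X. \<Sum>i\<in>I. n i x) = (\<Sum>x\<in>X. (cmod (\<psi> x))\<^sup>2)"
    unfolding n_def sum_norms_eq[OF isometry, symmetric] by (rule sum.swap)
  finally show ?thesis .
qed

text \<open>Duality: the distance is an l1 norm, so pairing the deviation with any test function
  bounded by 1 bounds it from below.\<close>

lemma test_le_mix_dist:
  assumes T: "T > 0" and f: "\<And>x. x \<in> X \<Longrightarrow> cmod (f x) \<le> 1"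
  shows "cmod (\<Sum>i\<in>I. \<Sum>j\<in>I - {i}. (\<Sum>x\<in>X. f x * \<phi> i x * cnj (\<phi> j x)) * power_mean T (\<mu> i * cnj (\<mu> j)))
     \<le> mix_dist X U T \<psi>"
proof -
  have "(\<Sum>i\<in>I. \<Sum>j\<in>I - {i}. (\<Sum>x\<in>X. f x * \<phi> i x * cnj (\<phi> j x)) * power_mean T (\<mu> i * cnj (\<mu> j)))
      = (\<Sum>x\<in>X. f x * of_real (time_avg U \<psi> T x - limit_dist U \<psi> x))"
    unfolding deviation_eq[OF T] sum_distrib_left sum_distrib_right
    by (subst (2) sum.swap, subst (3) sum.swap) (simp add: sum.swap[of _ X] mult.assoc)
  also have "cmod \<dots> \<le> (\<Sum>x\<in>X. cmod (f x) * \<bar>time_avg U \<psi> T x - limit_dist U \<psi> x\<bar>)"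
    by (rule norm_sum[THEN order_trans]) (simp add: norm_mult del: of_real_diff)
  also have "\<dots> \<le> mix_dist X U T \<psi>"
    unfolding mix_dist_def using f by (intro sum_mono mult_left_le_one_le) auto
  finally show ?thesis .
qed

end

section \<open>Mixing-time bounds from distance bounds\<close>

text \<open>One time at which one unit vector is still too far away excludes every threshold up to
  that time. If no threshold is left, the infimum is infinite and the bound still holds.\<close>

lemma mixing_time_ge:
  assumes "\<psi> \<in> L2 X" "L2_norm X \<psi> = 1" "mix_dist X U T \<psi> > \<epsilon>"
  shows "mixing_time X U \<epsilon> \<ge> ereal (real T)"
  unfolding mixing_time_def
proof (rule SUP_upper2[of \<psi>])
  show "ereal (real T) \<le> (INF T\<in>{T. 1 \<le> T \<and> (\<forall>T'\<ge>T. mix_dist X U T' \<psi> \<le> \<epsilon>)}. ereal (real T))"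
  proof (rule INF_greatest)
    fix N assume "N \<in> {T. 1 \<le> T \<and> (\<forall>T'\<ge>T. mix_dist X U T' \<psi> \<le> \<epsilon>)}"
    then have "\<not> N \<le> T" using assms(3) by force
    then show "ereal (real T) \<le> ereal (real N)" by simp
  qed
qed (use assms in auto)

text \<open>Thresholds start at 1. This crude bound later covers the finitely many short
  cycles.\<close>

lemma mixing_time_ge_one:
  assumes "\<psi> \<in> L2 X" "L2_norm X \<psi> = 1"
  shows "mixing_time X U \<epsilon> \<ge> 1"
  unfolding mixing_time_def
  by (rule SUP_upper2[of \<psi>]) (use assms in \<open>auto intro!: INF_greatest\<close>)

lemma mixing_time_le:
  assumes "N \<ge> 1"
    and "\<And>\<psi> T. \<psi> \<in> L2 X \<Longrightarrow> L2_norm X \<psi> = 1 \<Longrightarrow> T \<ge> N \<Longrightarrow> mix_dist X U T \<psi> \<le> \<epsilon>"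
  shows "mixing_time X U \<epsilon> \<le> ereal (real N)"
  unfolding mixing_time_def by (rule SUP_least, rule INF_lower) (use assms in auto)

section \<open>The walk on plane waves\<close>

definition wave :: "nat \<Rightarrow> int \<Rightarrow> int \<Rightarrow> complex" where
  "wave n k v = cis (2 * pi * (real_of_int k * real_of_int v / real n))"

lemma norm_wave [simp]: "cmod (wave n k v) = 1"
  by (simp add: wave_def)

lemma cnj_wave: "cnj (wave n k v) = wave n (- k) v"
  by (simp add: wave_def cis_cnj)

lemma wave_add: "wave n (k + l) v = wave n k v * wave n l v"
  by (simp add: wave_def cis_mult ring_distribs add_divide_distrib)

lemma wave_add_right: "wave n k (v + w) = wave n k v * wave n k w"
  by (simp add: wave_def cis_mult ring_distribs add_divide_distrib)

lemma wave_swap: "wave n k v = wave n v k"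
  by (simp add: wave_def mult.commute)

lemma wave_0 [simp]: "wave n 0 v = 1"
  by (simp add: wave_def)

lemma wave_multiple:
  assumes "n > 0"
  shows "wave n k (int n * q) = 1"
proof -
  have "wave n k (int n * q) = cis (2 * pi * real_of_int (k * q))"
    using assms by (simp add: wave_def)
  then show ?thesis by (simp only: cis_multiple_2pi Ints_of_int)
qed

lemma wave_mod:
  assumes "n > 0"
  shows "wave n k (v mod int n) = wave n k v"
proof -
  have "wave n k v = wave n k (v mod int n) * wave n k (int n * (v div int n))"
    by (simp flip: wave_add_right)
  then show ?thesis by (simp add: wave_multiple[OF assms])
qed

lemma wave_eq_1_imp_dvd:
  assumes "n > 0" "wave n k 1 = 1"
  shows "int n dvd k"
proof -
  have "cos (2 * pi * (real_of_int k / real n)) = 1"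
    using arg_cong[OF assms(2), of Re] by (simp add: wave_def)
  then obtain q :: int where "2 * pi * (real_of_int k / real n) = of_int q * 2 * pi"
    using cos_one_2pi_int by (metis mult.assoc)
  then have "real_of_int k = of_int (int n * q)"
    using assms(1) by (simp add: field_simps)
  then show ?thesis by (metis of_int_eq_iff dvd_triv_left)
qed

text \<open>Orthogonality of characters: unless \<open>n\<close> divides \<open>k\<close>,
  \<open>wave n k 1\<close> is a nontrivial \<open>n\<close>-th root of unity and the geometric sum
  vanishes.\<close>

lemma sum_wave:
  assumes n: "n > 0"
  shows "(\<Sum>v\<in>{0..<int n}. wave n k v) = (if int n dvd k then of_nat n else 0)"
proof (cases "int n dvd k")
  case True
  then obtain q where "k = int n * q" ..
  then have "wave n k v = 1" for v
    by (metis n wave_multiple wave_swap)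
  then show ?thesis using True by simp
next
  case False
  have power: "wave n k (int t) = wave n k 1 ^ t" for t
    by (simp add: wave_def DeMoivre algebra_simps)
  have "(\<Sum>v\<in>{0..<int n}. wave n k v) = (\<Sum>t<n. wave n k 1 ^ t)"
    by (rule sum.reindex_bij_witness[of _ int nat]) (auto simp flip: power)
  also have "\<dots> = 0"
    using False wave_eq_1_imp_dvd[OF n, of k] wave_multiple[OF n, of k 1]
    by (subst geometric_sum) (auto simp flip: power)
  finally show ?thesis using False by simp
qed

section \<open>The walk in position space\<close>

text \<open>A character times a coin vector \<open>w\<close>, cut off outside the state set so as to
  lie in \<open>L2\<close>.\<close>

definition plane_wave :: "nat \<Rightarrow> int \<Rightarrow> (nat \<Rightarrow> complex) \<Rightarrow> int \<times> nat \<Rightarrow> complex" where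
  "plane_wave n k w = (\<lambda>x. if x \<in> cycle_states n then wave n k (fst x) * w (snd x) else 0)"

lemma sum_cycle_states:
  "(\<Sum>x\<in>cycle_states n. f x) = (\<Sum>v\<in>{0..<int n}. f (v, 1) + f (v, 2))"
  unfolding cycle_states_def using sum.cartesian_product[of "\<lambda>v s. f (v, s)" "{1, 2}" "{0..<int n}"] by simp

lemma mod_succ_eq_iff:
  fixes u v :: int
  assumes "0 \<le> v" "v < m" "0 \<le> u" "u < m"
  shows "v = (u + 1) mod m \<longleftrightarrow> u = (v - 1) mod m" "v = (u - 1) mod m \<longleftrightarrow> u = (v + 1) mod m"
  using assms by (metis add_diff_cancel diff_add_cancel mod_add_left_eq mod_diff_left_eq mod_pos_pos_trivial)+

text \<open>The definition pushes amplitudes forward; here the walk is read backward. Vertex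
  \<open>v\<close> is reached from \<open>v - 1\<close> with label 1 and from \<open>v + 1\<close>
  with label 2, and the minus sign is the coin entry in row 2, column 1.\<close>

lemma hadamard_walk_eq:
  assumes "n > 0"
  shows "hadamard_walk n \<psi> = (\<lambda>(v, s). if (v, s) \<in> cycle_states n
     then ((if s = 1 then 1 else - 1) * \<psi> ((v - 1) mod int n, 1) + \<psi> ((v + 1) mod int n, 2)) / of_real (sqrt 2)
     else 0)"
proof (rule ext, clarify)
  fix v :: int and s :: nat
  have range: "u mod int n \<in> {0..<int n}" for u using assms by simp
  have walk: "hadamard_walk n \<psi> (v, s) = (\<Sum>u\<in>{0..<int n}.
      \<psi> (u, 1) * (hadamard_coin 1 1 * delta ((u + 1) mod int n, 1) (v, s) +
        hadamard_coin 2 1 * delta ((u + 1) mod int n, 2) (v, s)) +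
      \<psi> (u, 2) * (hadamard_coin 1 2 * delta ((u - 1) mod int n, 1) (v, s) +
        hadamard_coin 2 2 * delta ((u - 1) mod int n, 2) (v, s)))"
    unfolding hadamard_walk_def sum_cycle_states by (simp add: cycle_nbr_def)
  show "hadamard_walk n \<psi> (v, s) = (if (v, s) \<in> cycle_states n
     then ((if s = 1 then 1 else - 1) * \<psi> ((v - 1) mod int n, 1) + \<psi> ((v + 1) mod int n, 2)) / of_real (sqrt 2)
     else 0)"
  proof (cases "(v, s) \<in> cycle_states n")
    case False
    then have "delta (u mod int n, s') (v, s) = 0" if "s' \<in> {1, 2}" for u s'
      using range that by (auto simp: delta_def cycle_states_def)
    then show ?thesis using False by (simp add: walk)
  next
    case True
    then have v: "0 \<le> v" "v < int n" and s: "s = 1 \<or> s = 2" by (auto simp: cycle_states_def)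
    have "hadamard_walk n \<psi> (v, s) = (\<Sum>u\<in>{0..<int n}.
       (if u = (v - 1) mod int n then (if s = 1 then 1 else - 1) * \<psi> (u, 1) / of_real (sqrt 2) else 0) +
       (if u = (v + 1) mod int n then \<psi> (u, 2) / of_real (sqrt 2) else 0))"
      unfolding walk using s mod_succ_eq_iff[OF v]
      by (intro sum.cong) (auto simp: delta_def hadamard_coin_def)
    also have "\<dots> = ((if s = 1 then 1 else - 1) * \<psi> ((v - 1) mod int n, 1) + \<psi> ((v + 1) mod int n, 2)) / of_real (sqrt 2)"
      unfolding sum.distrib using range by (simp add: sum.delta add_divide_distrib)
    finally show ?thesis using True by simp
  qed
qed

lemma finite_cycle_states [simp]: "finite (cycle_states n)"
  by (simp add: cycle_states_def)

lemma hadamard_walk_sum: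
  assumes "n > 0" "finite I"
  shows "hadamard_walk n (\<lambda>x. \<Sum>i\<in>I. c i * f i x) = (\<lambda>x. \<Sum>i\<in>I. c i * hadamard_walk n (f i) x)"
  unfolding hadamard_walk_eq[OF assms(1)]
  by (auto simp: fun_eq_iff sum_divide_distrib sum_distrib_left sum_negf sum.distrib
      algebra_simps add_divide_distrib diff_divide_distrib sum_subtractf)

text \<open>At each vertex the coin preserves the norm by the parallelogram law, and the two cyclic
  shifts only permute the vertices.\<close>

lemma hadamard_walk_isometry:
  assumes n: "n > 0"
  shows "(\<Sum>x\<in>cycle_states n. (cmod (hadamard_walk n f x))\<^sup>2) = (\<Sum>x\<in>cycle_states n. (cmod (f x))\<^sup>2)"
proof -
  have parallelogram: "(cmod ((a + b) / of_real (sqrt 2)))\<^sup>2 + (cmod ((- a + b) / of_real (sqrt 2)))\<^sup>2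
      = (cmod a)\<^sup>2 + (cmod b)\<^sup>2" for a b :: complex
    unfolding norm_divide power_divide cmod_power2
    by (simp add: power2_eq_square field_simps)
  have shift: "(\<Sum>v\<in>{0..<int n}. g ((v + d) mod int n)) = (\<Sum>v\<in>{0..<int n}. g v :: real)" for g d
  proof (rule sum.reindex_bij_witness[of _ "\<lambda>v. (v - d) mod int n" "\<lambda>v. (v + d) mod int n"])
  qed (use n in \<open>auto simp: mod_simps\<close>)
  have "(\<Sum>x\<in>cycle_states n. (cmod (hadamard_walk n f x))\<^sup>2) =
     (\<Sum>v\<in>{0..<int n}. (cmod (f ((v - 1) mod int n, 1)))\<^sup>2 + (cmod (f ((v + 1) mod int n, 2)))\<^sup>2)"
    unfolding sum_cycle_states
  proof (rule sum.cong)
    fix v assume "v \<in> {0..<int n}"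
    then show "(cmod (hadamard_walk n f (v, 1)))\<^sup>2 + (cmod (hadamard_walk n f (v, 2)))\<^sup>2 =
        (cmod (f ((v - 1) mod int n, 1)))\<^sup>2 + (cmod (f ((v + 1) mod int n, 2)))\<^sup>2"
      using parallelogram[of "f ((v - 1) mod int n, 1)" "f ((v + 1) mod int n, 2)"]
      by (simp add: hadamard_walk_eq[OF n] cycle_states_def)
  qed simp
  also have "\<dots> = (\<Sum>x\<in>cycle_states n. (cmod (f x))\<^sup>2)"
    using shift[of "\<lambda>v. (cmod (f (v, 1)))\<^sup>2" "- 1"] shift[of "\<lambda>v. (cmod (f (v, 2)))\<^sup>2" 1]
    by (simp add: sum_cycle_states sum.distrib)
  finally show ?thesis .
qed

section \<open>The two-dimensional Fourier blocks\<close>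

text \<open>The Fourier block at angle \<theta>: the coin matrix times the diagonal matrix with
  entries \<open>cis (- \<theta>)\<close> and \<open>cis \<theta>\<close>, the phases of the two
  shifts.\<close>

definition coin_step :: "real \<Rightarrow> (nat \<Rightarrow> complex) \<Rightarrow> nat \<Rightarrow> complex" where
  "coin_step \<theta> w s = ((if s = 1 then 1 else - 1) * cis (- \<theta>) * w 1 + cis \<theta> * w 2) / of_real (sqrt 2)"

lemma hadamard_walk_plane_wave:
  assumes n: "n > 0"
  shows "hadamard_walk n (plane_wave n k w) = plane_wave n k (coin_step (2 * pi * k / n) w)"
proof -
  have [simp]: "wave n k (- 1) = cis (- (2 * pi * k / n))" "wave n k 1 = cis (2 * pi * k / n)"
    by (simp_all add: wave_def)
  have [simp]: "(u mod int n, s) \<in> cycle_states n \<longleftrightarrow> s \<in> {1, 2}" for u s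
    using n by (simp add: cycle_states_def)
  have "wave n k (v - 1) = wave n k v * wave n k (- 1)" for v
    using wave_add_right[of n k v "- 1"] by simp
  then show ?thesis
    by (auto simp: fun_eq_iff hadamard_walk_eq[OF n] plane_wave_def wave_mod[OF n] wave_add_right
        coin_step_def algebra_simps)
qed

text \<open>
  Each Fourier block has determinant \<open>1\<close> and trace \<open>sqrt 2 * cos \<theta>\<close>;
  \<open>\<sigma> = \<plusminus>1\<close> selects the sign of the imaginary part of the eigenvalue.
\<close>

definition eigval :: "real \<Rightarrow> real \<Rightarrow> complex" where
  "eigval \<sigma> \<theta> = Complex (cos \<theta> / sqrt 2) (\<sigma> * sqrt (1 - (cos \<theta>)\<^sup>2 / 2))"

lemma cos_sq_half_le: "(cos (\<theta>::real))\<^sup>2 / 2 \<le> 1 / 2"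
  using abs_cos_le_one[of \<theta>] by (simp add: abs_square_le_1)

lemma norm_eigval:
  assumes "\<sigma>\<^sup>2 = 1"
  shows "cmod (eigval \<sigma> \<theta>) = 1"
  using assms cos_sq_half_le[of \<theta>]
  by (simp add: eigval_def cmod_def power_mult_distrib power_divide)

text \<open>The characteristic equation of the block.\<close>

lemma eigval_square:
  assumes "\<sigma>\<^sup>2 = 1"
  shows "eigval \<sigma> \<theta> ^ 2 = of_real (sqrt 2 * cos \<theta>) * eigval \<sigma> \<theta> - 1"
proof -
  have "\<sigma> * \<sigma> = 1" using assms by (simp add: power2_eq_square)
  moreover have "sqrt (1 - (cos \<theta>)\<^sup>2 / 2) * sqrt (1 - (cos \<theta>)\<^sup>2 / 2) = 1 - (cos \<theta>)\<^sup>2 / 2"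
    using cos_sq_half_le[of \<theta>] by simp
  ultimately have "\<sigma> * sqrt (1 - (cos \<theta>)\<^sup>2 / 2) * (\<sigma> * sqrt (1 - (cos \<theta>)\<^sup>2 / 2)) = 1 - (cos \<theta>)\<^sup>2 / 2"
    by (metis (no_types, opaque_lifting) mult.assoc mult.left_commute mult_1)
  then show ?thesis
    by (simp add: eigval_def complex_eq_iff power2_eq_square field_simps)
qed

lemma eigval_sum: "eigval 1 \<theta> + eigval (- 1) \<theta> = of_real (sqrt 2 * cos \<theta>)"
  by (simp add: eigval_def complex_eq_iff real_div_sqrt field_simps)

lemma eigval_cong: "cos \<theta> = cos \<theta>' \<Longrightarrow> eigval \<sigma> \<theta> = eigval \<sigma> \<theta>'"
  by (simp add: eigval_def)

text \<open>Since the squared real part is at most 1/2, the eigenvalues stay away from the real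
  axis, and the two branches never meet.\<close>

lemma Im_eigval_ge: "Im (eigval 1 \<theta>) \<ge> 1 / sqrt 2"
  using real_sqrt_le_mono[of "1/2" "1 - (cos \<theta>)\<^sup>2 / 2"] cos_sq_half_le[of \<theta>]
  by (simp add: eigval_def real_sqrt_divide)

text \<open>Cayley-Hamilton for a block of determinant 1.\<close>

lemma coin_step_twice:
  assumes "s \<in> {1, 2}"
  shows "coin_step \<theta> (coin_step \<theta> w) s = of_real (sqrt 2 * cos \<theta>) * coin_step \<theta> w s - w s"
proof -
  have sq: "complex_of_real (sqrt 2) * of_real (sqrt 2) = 2" by (simp flip: of_real_mult)
  have c: "complex_of_real (cos \<theta>) = (cis \<theta> + cis (- \<theta>)) / 2" by (simp add: complex_eq_iff)
  have i: "cis \<theta> * cis (- \<theta>) = 1" by (simp add: cis_mult)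
  \<comment> \<open>With the phases and the root abstracted, the claim is a ring identity modulo
    \<open>a * b = 1\<close> and \<open>r\<^sup>2 = 2\<close>.\<close>
  define a b r where "a = cis \<theta>" and "b = cis (- \<theta>)" and "r = complex_of_real (sqrt 2)"
  have [simp]: "r \<noteq> 0" by (simp add: r_def)
  have rr: "r\<^sup>2 = 2" using sq by (simp add: r_def power2_eq_square)
  have ab: "a * b = 1" using i by (simp add: a_def b_def)
  have abx: "a * (b * x) = x" for x using ab by (metis mult.assoc mult_1)
  show ?thesis using assms
    unfolding coin_step_def of_real_mult c a_def[symmetric] b_def[symmetric] r_def[symmetric]
    using ab abx rr by (auto simp: field_simps power2_eq_square)
qed

lemma eigval_mult: "eigval 1 \<theta> * eigval (- 1) \<theta> = 1"
proof -
  have "eigval (- 1) \<theta> = cnj (eigval 1 \<theta>)" by (simp add: eigval_def complex_eq_iff)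
  then show ?thesis
    using complex_norm_square[of "eigval 1 \<theta>"] by (simp add: norm_eigval)
qed

lemma coin_step_diff:
  "coin_step \<theta> (\<lambda>s. a s - c * b s) s = coin_step \<theta> a s - c * coin_step \<theta> b s"
  by (simp add: coin_step_def field_simps)

text \<open>The characteristic polynomial factors, so the block minus one eigenvalue maps every
  vector into the eigenspace of the other.\<close>

lemma coin_step_eigen:
  assumes "\<sigma> \<in> {1, - 1}" "s \<in> {1, 2}"
  shows "coin_step \<theta> (\<lambda>s. coin_step \<theta> w s - eigval (- \<sigma>) \<theta> * w s) s =
     eigval \<sigma> \<theta> * (coin_step \<theta> w s - eigval (- \<sigma>) \<theta> * w s)"
proof -
  have trace: "complex_of_real (sqrt 2 * cos \<theta>) = eigval \<sigma> \<theta> + eigval (- \<sigma>) \<theta>"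
    and det: "eigval \<sigma> \<theta> * eigval (- \<sigma>) \<theta> = 1"
    using assms(1) eigval_sum[of \<theta>] eigval_mult[of \<theta>] by (auto simp: ac_simps)
  have "coin_step \<theta> (\<lambda>s. coin_step \<theta> w s - eigval (- \<sigma>) \<theta> * w s) s =
     coin_step \<theta> (coin_step \<theta> w) s - eigval (- \<sigma>) \<theta> * coin_step \<theta> w s"
    by (rule coin_step_diff)
  also have "\<dots> = eigval \<sigma> \<theta> * coin_step \<theta> w s - (eigval \<sigma> \<theta> * eigval (- \<sigma>) \<theta>) * w s"
    unfolding coin_step_twice[OF assms(2)] trace det by (simp add: algebra_simps)
  finally show ?thesis by (simp add: algebra_simps)
qed

section \<open>Completeness of the eigenvectors\<close>

text \<open>Frequencies \<open>k\<close> and \<open>n - k\<close> have equal cosines, so half of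
  them give all eigenvalues. Taking a set merges degenerate eigenvalues, as
  \<open>eigen_expansion\<close> requires.\<close>

definition spectrum :: "nat \<Rightarrow> complex set" where
  "spectrum n = (\<lambda>(\<sigma>, k). eigval \<sigma> (2 * pi * real k / real n)) ` ({1, - 1} \<times> {0..n div 2})"

lemma finite_spectrum [simp]: "finite (spectrum n)"
  by (simp add: spectrum_def)

lemma norm_spectrum: "\<mu> \<in> spectrum n \<Longrightarrow> cmod \<mu> = 1"
  by (auto simp: spectrum_def norm_eigval)

lemma eigval_in_spectrum:
  assumes "k < n" "\<sigma> \<in> {1, - 1}"
  shows "eigval \<sigma> (2 * pi * real k / real n) \<in> spectrum n"
proof (cases "k \<le> n div 2")
  case True
  then show ?thesis using assms(2) unfolding spectrum_def by force
next
  case False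
  have "2 * pi * real k / real n = 2 * pi - 2 * pi * real (n - k) / real n"
    using assms(1) by (simp add: field_simps of_nat_diff)
  then have "eigval \<sigma> (2 * pi * real k / real n) = eigval \<sigma> (2 * pi * real (n - k) / real n)"
    by (intro eigval_cong) (simp only: cos_2pi_minus)
  moreover have "n - k \<in> {0..n div 2}" using False by auto
  ultimately show ?thesis using assms(2) unfolding spectrum_def by force
qed

text \<open>There is one component per eigenvalue, possibly zero; contributions of different
  frequencies to the same eigenvalue are added into one component.\<close>

definition eigen_sum :: "nat \<Rightarrow> (int \<times> nat \<Rightarrow> complex) \<Rightarrow> bool" where
  "eigen_sum n \<psi> \<longleftrightarrow> (\<exists>\<phi>. (\<forall>\<mu>\<in>spectrum n. hadamard_walk n (\<phi> \<mu>) = (\<lambda>x. \<mu> * \<phi> \<mu> x)) \<and>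
     \<psi> = (\<lambda>x. \<Sum>\<mu>\<in>spectrum n. \<phi> \<mu> x))"

lemma hadamard_walk_add:
  assumes "n > 0"
  shows "hadamard_walk n (\<lambda>x. f x + g x) = (\<lambda>x. hadamard_walk n f x + hadamard_walk n g x)"
  using hadamard_walk_sum[OF assms, of "{0, 1::nat}" "\<lambda>_. 1" "\<lambda>i. if i = 0 then f else g"]
  by simp

lemma eigen_sum_add:
  assumes "n > 0" "eigen_sum n f" "eigen_sum n g"
  shows "eigen_sum n (\<lambda>x. f x + g x)"
proof -
  obtain \<phi> where \<phi>: "\<And>\<mu>. \<mu> \<in> spectrum n \<Longrightarrow> hadamard_walk n (\<phi> \<mu>) = (\<lambda>x. \<mu> * \<phi> \<mu> x)"
    and f: "f = (\<lambda>x. \<Sum>\<mu>\<in>spectrum n. \<phi> \<mu> x)"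
    using assms(2) unfolding eigen_sum_def by metis
  obtain \<chi> where \<chi>: "\<And>\<mu>. \<mu> \<in> spectrum n \<Longrightarrow> hadamard_walk n (\<chi> \<mu>) = (\<lambda>x. \<mu> * \<chi> \<mu> x)"
    and g: "g = (\<lambda>x. \<Sum>\<mu>\<in>spectrum n. \<chi> \<mu> x)"
    using assms(3) unfolding eigen_sum_def by metis
  show ?thesis unfolding eigen_sum_def
  proof (intro exI conjI ballI)
    fix \<mu> assume "\<mu> \<in> spectrum n"
    then show "hadamard_walk n (\<lambda>x. \<phi> \<mu> x + \<chi> \<mu> x) = (\<lambda>x. \<mu> * (\<phi> \<mu> x + \<chi> \<mu> x))"
      by (subst hadamard_walk_add[OF assms(1)]) (simp add: \<phi> \<chi> distrib_left)
  qed (simp add: f g sum.distrib)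
qed

lemma eigen_sum_single:
  assumes "n > 0" "\<mu> \<in> spectrum n" "hadamard_walk n f = (\<lambda>x. \<mu> * f x)"
  shows "eigen_sum n f"
  unfolding eigen_sum_def
proof (intro exI conjI ballI)
  \<comment> \<open>All other components are zero, which the walk fixes: this is linearity for the
    empty sum.\<close>
  have [simp]: "hadamard_walk n (\<lambda>_. 0) = (\<lambda>_. 0)"
    using hadamard_walk_sum[OF assms(1), of "{}"] by simp
  show "hadamard_walk n ((\<lambda>\<nu> x. if \<nu> = \<mu> then f x else 0) \<nu>) = (\<lambda>x. \<nu> * (if \<nu> = \<mu> then f x else 0))" for \<nu>
    using assms by (cases "\<nu> = \<mu>") auto
  show "f = (\<lambda>x. \<Sum>\<nu>\<in>spectrum n. if \<nu> = \<mu> then f x else 0)"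
    using assms(2) by simp
qed

lemma eigen_sum_sum:
  assumes "n > 0" "finite K" "K \<noteq> {}" "\<And>k. k \<in> K \<Longrightarrow> eigen_sum n (f k)"
  shows "eigen_sum n (\<lambda>x. \<Sum>k\<in>K. f k x)"
  using assms(2,3,4) by (induction K rule: finite_ne_induct) (auto intro: eigen_sum_add[OF assms(1)])

lemma plane_wave_cong:
  "(\<And>s. s \<in> {1, 2} \<Longrightarrow> w s = w' s) \<Longrightarrow> plane_wave n k w = plane_wave n k w'"
  by (auto simp: plane_wave_def cycle_states_def fun_eq_iff)

lemma plane_wave_scale: "plane_wave n k (\<lambda>s. c * w s) = (\<lambda>x. c * plane_wave n k w x)"
  by (auto simp: plane_wave_def)

lemma hadamard_walk_plane_wave_eigen:
  assumes "n > 0" "\<And>s. s \<in> {1, 2} \<Longrightarrow> coin_step (2 * pi * k / n) w s = \<mu> * w s"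
  shows "hadamard_walk n (plane_wave n k w) = (\<lambda>x. \<mu> * plane_wave n k w x)"
  using plane_wave_cong[OF assms(2)] by (simp add: hadamard_walk_plane_wave[OF assms(1)] plane_wave_scale)

text \<open>Subtracting the two eigenvectors supplied by \<open>coin_step_eigen\<close> leaves
  \<delta> times \<open>w\<close>, where \<delta> is the difference of the eigenvalues. Its
  imaginary part is positive, so \<delta> can be divided out.\<close>

lemma eigen_sum_plane_wave:
  assumes "k < n"
  shows "eigen_sum n (plane_wave n (int k) w)"
proof -
  have n: "n > 0" using assms by simp
  define \<theta> where "\<theta> = 2 * pi * real k / real n"
  define \<delta> where "\<delta> = eigval 1 \<theta> - eigval (- 1) \<theta>"
  have "Im \<delta> = 2 * Im (eigval 1 \<theta>)" by (simp add: \<delta>_def eigval_def)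
  moreover have "1 / sqrt 2 > 0" by simp
  ultimately have "Im \<delta> > 0" using Im_eigval_ge[of \<theta>] by linarith
  then have "\<delta> \<noteq> 0" by auto
  define part where "part \<sigma> = (\<lambda>s. coin_step \<theta> w s - eigval (- \<sigma>) \<theta> * w s)" for \<sigma>
  have part: "eigen_sum n (plane_wave n (int k) (\<lambda>s. c * part \<sigma> s))" if \<sigma>: "\<sigma> \<in> {1, - 1}" for \<sigma> c
  proof (rule eigen_sum_single[OF n eigval_in_spectrum[OF assms \<sigma>] hadamard_walk_plane_wave_eigen[OF n]])
    fix s :: nat assume s: "s \<in> {1, 2}"
    have "coin_step \<theta> (\<lambda>s. c * part \<sigma> s) s = c * coin_step \<theta> (part \<sigma>) s"
      by (simp add: coin_step_def field_simps)
    then show "coin_step (2 * pi * real_of_int (int k) / real n) (\<lambda>s. c * part \<sigma> s) s =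
        eigval \<sigma> (2 * pi * real k / real n) * (c * part \<sigma> s)"
      using coin_step_eigen[OF \<sigma> s, of \<theta> w] by (simp add: part_def \<theta>_def)
  qed
  have "w s = 1 / \<delta> * part 1 s + - 1 / \<delta> * part (- 1) s" for s
  proof -
    have "part 1 s - part (- 1) s = \<delta> * w s" by (simp add: part_def \<delta>_def algebra_simps)
    then show ?thesis using \<open>\<delta> \<noteq> 0\<close> by (simp add: field_simps)
  qed
  then have "plane_wave n (int k) w =
      (\<lambda>x. plane_wave n (int k) (\<lambda>s. 1 / \<delta> * part 1 s) x + plane_wave n (int k) (\<lambda>s. - 1 / \<delta> * part (- 1) s) x)"
    by (simp add: plane_wave_def fun_eq_iff right_diff_distrib diff_divide_distrib)
  then show ?thesis
    by (simp only:) (rule eigen_sum_add[OF n part part], simp_all)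
qed

text \<open>After interchanging the sums, orthogonality in the frequency variable leaves only the
  term \<open>u = v\<close>.\<close>

lemma fourier_inversion:
  assumes n: "n > 0" and \<psi>: "\<psi> \<in> L2 (cycle_states n)"
  shows "\<psi> = (\<lambda>x. \<Sum>k<n. plane_wave n (int k)
     (\<lambda>s. (\<Sum>u\<in>{0..<int n}. \<psi> (u, s) * wave n (- int k) u) / of_nat n) x)"
proof (rule ext, clarify)
  fix v s
  show "\<psi> (v, s) = (\<Sum>k<n. plane_wave n (int k)
     (\<lambda>s. (\<Sum>u\<in>{0..<int n}. \<psi> (u, s) * wave n (- int k) u) / of_nat n) (v, s))"
  proof (cases "(v, s) \<in> cycle_states n")
    case False
    then show ?thesis using \<psi> by (simp add: L2_def plane_wave_def)
  next
    case True
    then have v: "v \<in> {0..<int n}" by (auto simp: cycle_states_def)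
    have orth: "(\<Sum>k<n. wave n (int k) v * wave n (- int k) u) = (if u = v then of_nat n else 0)"
      if u: "u \<in> {0..<int n}" for u
    proof -
      have "(\<Sum>k<n. wave n (int k) v * wave n (- int k) u) = (\<Sum>k<n. wave n (v - u) (int k))"
        by (intro sum.cong) (simp_all add: wave_def cis_mult algebra_simps diff_divide_distrib)
      also have "\<dots> = (\<Sum>k\<in>{0..<int n}. wave n (v - u) k)"
        by (rule sum.reindex_bij_witness[of _ nat int]) auto
      \<comment> \<open>Both vertices are residues below \<open>n\<close>, so divisibility of their
        difference forces equality.\<close>
      also have "int n dvd v - u \<longleftrightarrow> u = v"
      proof
        assume "int n dvd v - u"
        then have "v - u \<noteq> 0 \<Longrightarrow> int n \<le> \<bar>v - u\<bar>"
          using dvd_imp_le_int[of "v - u" "int n"] by simp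
        then show "u = v" using u v by (cases "v - u = 0") auto
      qed simp
      ultimately show ?thesis by (simp add: sum_wave[OF n])
    qed
    have "(\<Sum>k<n. plane_wave n (int k)
        (\<lambda>s. (\<Sum>u\<in>{0..<int n}. \<psi> (u, s) * wave n (- int k) u) / of_nat n) (v, s))
      = (\<Sum>u\<in>{0..<int n}. \<psi> (u, s) * (\<Sum>k<n. wave n (int k) v * wave n (- int k) u) / of_nat n)"
      using True unfolding plane_wave_def sum_distrib_left sum_divide_distrib
      by (subst sum.swap) (simp add: sum_distrib_left mult_ac)
    also have "\<dots> = (\<Sum>u\<in>{0..<int n}. if u = v then \<psi> (u, s) else 0)"
      using n by (intro sum.cong) (simp_all add: orth)
    finally show ?thesis using v by simp
  qed
qed

lemma eigen_sum_L2:
  assumes "n > 0" "\<psi> \<in> L2 (cycle_states n)"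
  shows "eigen_sum n \<psi>"
  by (subst fourier_inversion[OF assms])
     (use assms in \<open>auto intro!: eigen_sum_sum eigen_sum_plane_wave\<close>)

section \<open>Spectral gaps and the upper bound\<close>

text \<open>The Taylor bound gives sin x at least \<open>x - x ^ 3 / 6\<close>, and x at most 2
  makes the cubic term at most \<open>2 * x / 3\<close>.\<close>

lemma sin_ge_third:
  assumes "0 \<le> x" "x \<le> pi / 2"
  shows "x / 3 \<le> sin (x::real)"
proof -
  have "\<bar>sin x - (\<Sum>m<3. sin_coeff m * x ^ m)\<bar> \<le> inverse (fact 3) * \<bar>x\<bar> ^ 3"
    by (rule Maclaurin_sin_bound)
  then have bound: "\<bar>sin x - x\<bar> \<le> x ^ 3 / 6"
    using assms by (simp add: sin_coeff_def numeral_3_eq_3 fact_numeral)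
  have "x \<le> 2" using assms pi_less_4 by simp
  then have "x * x ^ 2 \<le> x * 2 ^ 2"
    using assms by (intro mult_left_mono power_mono) auto
  then have "x ^ 3 \<le> 4 * x" by (simp add: power3_eq_cube power2_eq_square)
  then show ?thesis using bound by linarith
qed

text \<open>The difference is \<open>2 * sin y * sin x\<close> with half-difference \<open>x\<close>
  and half-sum \<open>y\<close>. As \<open>y\<close> lies between \<open>x\<close> and
  \<open>pi - x\<close>, both sines are at least \<open>x / 3\<close>; with \<open>x\<close> at
  least \<open>2 * (l - k) / n\<close> the constant is 2/9 times 4.\<close>

lemma cos_gap:
  assumes "k \<le> n div 2" "l \<le> n div 2" "n > 0"
  shows "\<bar>cos (2 * pi * real k / n) - cos (2 * pi * real l / n)\<bar> \<ge> 8 / 9 * (real k - real l)\<^sup>2 / (real n)\<^sup>2"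
  using assms
proof (induction k l rule: linorder_wlog)
  case (sym l k)
  then show ?case by (simp add: abs_minus_commute power2_commute)
next
  case (le k l)
  define x y where "x = pi * (real l - real k) / n" and "y = pi * (real k + real l) / n"
  have l: "2 * real l \<le> real n" using le.prems by linarith
  have 1: "0 \<le> x" "x \<le> y"
    unfolding x_def y_def using le by (auto intro!: divide_right_mono mult_left_mono)
  have "x + y = pi * (2 * real l / n)" by (simp add: x_def y_def add_divide_distrib[symmetric]) (simp add: algebra_simps)
  also have "\<dots> \<le> pi * 1" using l \<open>n > 0\<close> by (intro mult_left_mono) auto
  finally have 2: "x + y \<le> pi" by simp
  have x3: "x / 3 \<le> sin x" using 1 2 by (intro sin_ge_third) auto
  have y3: "sin x \<le> sin y"
  proof (cases "y \<le> pi / 2")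
    case True
    then show ?thesis using 1 by (intro sin_monotone_2pi_le) auto
  next
    case False
    then have "sin x \<le> sin (pi - y)" using 1 2 by (intro sin_monotone_2pi_le) auto
    then show ?thesis by simp
  qed
  have "cos (2 * pi * real k / n) - cos (2 * pi * real l / n) = 2 * sin y * sin x"
  proof -
    have "2 * pi * real k / n = y - x" "2 * pi * real l / n = y + x"
      by (simp_all add: x_def y_def algebra_simps flip: add_divide_distrib diff_divide_distrib)
    then show ?thesis by (simp add: cos_diff cos_add)
  qed
  moreover have "(x / 3) * (x / 3) \<le> sin y * sin x"
    using 1 x3 y3 by (intro mult_mono) auto
  moreover have "2 * (real l - real k) / n \<le> x"
    unfolding x_def using le pi_ge_two by (intro divide_right_mono mult_right_mono) auto
  then have "(2 * (real l - real k) / n)\<^sup>2 \<le> x\<^sup>2"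
    using le by (intro power_mono) auto
  moreover have "(2 * (real l - real k) / n)\<^sup>2 = 4 * ((real k - real l)\<^sup>2 / (real n)\<^sup>2)"
    by (simp add: power_divide power2_eq_square algebra_simps)
  moreover have "(x / 3) * (x / 3) = x\<^sup>2 / 9" by (simp add: power2_eq_square)
  ultimately show ?case by simp
qed

text \<open>The real parts \<open>cos \<theta> / sqrt 2\<close> are the same on both branches, so
  the cosine gap serves for any pair of signs.\<close>

lemma eigval_gap:
  assumes "k \<le> n div 2" "l \<le> n div 2" "n > 0"
  shows "cmod (eigval \<sigma> (2 * pi * real k / n) - eigval \<sigma>' (2 * pi * real l / n)) \<ge> (real k - real l)\<^sup>2 / (2 * (real n)\<^sup>2)"
proof -
  have "sqrt 2 \<le> 3 / 2" by (rule real_le_lsqrt) (auto simp: power2_eq_square)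
  then have "1 / 2 \<le> 8 / 9 / sqrt 2" by (simp add: field_simps)
  then have "1 / 2 * ((real k - real l)\<^sup>2 / (real n)\<^sup>2) \<le> 8 / 9 / sqrt 2 * ((real k - real l)\<^sup>2 / (real n)\<^sup>2)"
    by (intro mult_right_mono) auto
  also have "\<dots> \<le> \<bar>cos (2 * pi * real k / n) - cos (2 * pi * real l / n)\<bar> / sqrt 2"
    using divide_right_mono[OF cos_gap[OF assms], of "sqrt 2"] by (simp add: field_simps)
  also have "\<dots> = \<bar>Re (eigval \<sigma> (2 * pi * real k / n) - eigval \<sigma>' (2 * pi * real l / n))\<bar>"
    by (simp add: eigval_def abs_divide flip: diff_divide_distrib)
  also have "\<dots> \<le> cmod (eigval \<sigma> (2 * pi * real k / n) - eigval \<sigma>' (2 * pi * real l / n))"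
    by (rule abs_Re_le_cmod)
  finally show ?thesis by simp
qed

lemma eigval_conj_gap:
  assumes "\<sigma> \<in> {1, - 1}"
  shows "cmod (eigval \<sigma> \<theta> - eigval (- \<sigma>) \<theta>) \<ge> 1"
proof -
  have "sqrt 2 \<le> 2" by (rule real_le_lsqrt) auto
  then have "1 / 2 \<le> 1 / sqrt 2" by (simp add: field_simps)
  then have "1 / 2 \<le> Im (eigval 1 \<theta>)" using Im_eigval_ge[of \<theta>] by linarith
  then have "1 \<le> \<bar>Im (eigval \<sigma> \<theta> - eigval (- \<sigma>) \<theta>)\<bar>"
    using assms by (auto simp: eigval_def)
  then show ?thesis using abs_Im_le_cmod order_trans by blast
qed

section \<open>Closeness of low-frequency eigenvalues\<close>

text \<open>The imaginary parts \<open>p\<close> and \<open>q\<close> are at least 1/2, so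
  \<open>p + q\<close> is at least 1 and the difference of squares controls
  \<open>p - q\<close>.\<close>

lemma eigval_lipschitz: "cmod (eigval 1 \<theta> - eigval 1 \<theta>') \<le> 2 * \<bar>cos \<theta> - cos \<theta>'\<bar>"
proof -
  define p q where "p = sqrt (1 - (cos \<theta>)\<^sup>2 / 2)" and "q = sqrt (1 - (cos \<theta>')\<^sup>2 / 2)"
  have half: "1 / 2 \<le> 1 / sqrt 2" using real_le_lsqrt[of 2 2] by (simp add: field_simps)
  have pq: "p \<ge> 1 / 2" "q \<ge> 1 / 2"
    using order_trans[OF half Im_eigval_ge[of \<theta>]] order_trans[OF half Im_eigval_ge[of \<theta>']]
    by (simp_all add: p_def q_def eigval_def)
  have "p\<^sup>2 - q\<^sup>2 = ((cos \<theta>')\<^sup>2 - (cos \<theta>)\<^sup>2) / 2"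
    using cos_sq_half_le[of \<theta>] cos_sq_half_le[of \<theta>'] by (simp add: p_def q_def field_simps)
  then have "(p - q) * (p + q) = (cos \<theta>' - cos \<theta>) * ((cos \<theta>' + cos \<theta>) / 2)"
    by (simp add: power2_eq_square algebra_simps)
  then have "\<bar>p - q\<bar> * \<bar>p + q\<bar> = \<bar>cos \<theta> - cos \<theta>'\<bar> * \<bar>(cos \<theta>' + cos \<theta>) / 2\<bar>"
    by (metis abs_mult abs_minus_commute)
  also have "\<dots> \<le> \<bar>cos \<theta> - cos \<theta>'\<bar> * 1"
  proof (rule mult_left_mono)
    show "\<bar>(cos \<theta>' + cos \<theta>) / 2\<bar> \<le> 1"
      using abs_triangle_ineq[of "cos \<theta>'" "cos \<theta>"] abs_cos_le_one[of \<theta>] abs_cos_le_one[of \<theta>']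
      by (simp only: abs_divide abs_numeral divide_le_eq_numeral1)
  qed simp
  finally have "\<bar>p - q\<bar> * \<bar>p + q\<bar> \<le> \<bar>cos \<theta> - cos \<theta>'\<bar>" by simp
  moreover have "\<bar>p - q\<bar> * 1 \<le> \<bar>p - q\<bar> * \<bar>p + q\<bar>"
    using pq by (intro mult_left_mono) auto
  moreover have "\<bar>cos \<theta> / sqrt 2 - cos \<theta>' / sqrt 2\<bar> \<le> \<bar>cos \<theta> - cos \<theta>'\<bar>"
    by (simp add: abs_divide divide_le_eq mult_left_le flip: diff_divide_distrib)
       (simp add: mult_le_cancel_left1)
  moreover have "eigval 1 \<theta> - eigval 1 \<theta>' = Complex (cos \<theta> / sqrt 2 - cos \<theta>' / sqrt 2) (p - q)"
    by (simp add: eigval_def p_def q_def complex_eq_iff)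
  ultimately show ?thesis
    using cmod_le[of "eigval 1 \<theta> - eigval 1 \<theta>'"] by simp
qed

lemma one_minus_cos_le: "1 - cos (\<theta>::real) \<le> \<theta>\<^sup>2 / 2"
proof -
  have "1 - cos \<theta> = 2 * (sin (\<theta> / 2))\<^sup>2"
    using cos_double_sin[of "\<theta> / 2"] by simp
  moreover have "(sin (\<theta> / 2))\<^sup>2 \<le> (\<theta> / 2)\<^sup>2"
    using abs_sin_x_le_abs_x[of "\<theta> / 2"] unfolding abs_le_square_iff by simp
  ultimately show ?thesis by (simp add: power_divide)
qed

text \<open>The cosine is stationary at 0: angles up to \<open>8 * m / n\<close> put both cosines
  within \<open>32 * m\<^sup>2 / n\<^sup>2\<close> of 1, and the Lipschitz constant 2 doubles
  this.\<close>

lemma eigval_close: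
  assumes "n > 0" "k \<le> m" "l \<le> m"
  shows "cmod (eigval 1 (2 * pi * real k / n) - eigval 1 (2 * pi * real l / n)) \<le> 64 * (real m)\<^sup>2 / (real n)\<^sup>2"
proof -
  have "1 - cos (2 * pi * real k / n) \<le> 32 * (real m)\<^sup>2 / (real n)\<^sup>2" if "k \<le> m" for k
  proof -
    have "(2 * pi * real k / n)\<^sup>2 \<le> (2 * 4 * real m / n)\<^sup>2"
      using that pi_less_4 by (intro power_mono divide_right_mono mult_mono) auto
    then show ?thesis
      using one_minus_cos_le[of "2 * pi * real k / n"] by (simp add: power_mult_distrib power_divide)
  qed
  then have "\<bar>cos (2 * pi * real k / n) - cos (2 * pi * real l / n)\<bar> \<le> 32 * (real m)\<^sup>2 / (real n)\<^sup>2"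
    using assms cos_le_one[of "2 * pi * real k / n"] cos_le_one[of "2 * pi * real l / n"]
    by (smt (verit))
  then show ?thesis
    using order_trans[OF eigval_lipschitz mult_left_mono] by fastforce
qed

section \<open>Sums of inverse gaps and the upper bound\<close>

text \<open>Each term is at most a telescoping difference of consecutive reciprocals.\<close>

lemma sum_inverse_squares_le:
  assumes "m > 0"
  shows "(\<Sum>j=1..m. 1 / (real j)\<^sup>2) \<le> 2 - 1 / real m"
  using assms
proof (induction m rule: nat_induct_non_zero)
  case (Suc m)
  have "1 / (real (Suc m))\<^sup>2 \<le> 1 / (real m * real (Suc m))"
    using Suc.hyps by (intro divide_left_mono) (auto simp: power2_eq_square)
  also have "\<dots> = 1 / real m - 1 / real (Suc m)"
    using Suc.hyps by (simp add: field_simps)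
  finally have "1 / (real (Suc m))\<^sup>2 \<le> 1 / real m - 1 / real (Suc m)" .
  then show ?case using Suc.IH by simp
qed simp

lemma sum_inverse_square_distances_le:
  assumes "k \<le> m"
  shows "(\<Sum>l\<in>{0..m} - {k}. 1 / (real k - real l)\<^sup>2) \<le> 4"
proof -
  have two: "(\<Sum>j=1..m. 1 / (real j)\<^sup>2) \<le> 2" for m
    using sum_inverse_squares_le[of m] by (cases "m = 0") (auto intro: order_trans)
  have split: "{0..m} - {k} = {0..<k} \<union> {k<..m}" using assms by auto
  have "(\<Sum>l\<in>{0..m} - {k}. 1 / (real k - real l)\<^sup>2) =
      (\<Sum>l\<in>{0..<k}. 1 / (real k - real l)\<^sup>2) + (\<Sum>l\<in>{k<..m}. 1 / (real k - real l)\<^sup>2)"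
    unfolding split by (rule sum.union_disjoint) auto
  also have "(\<Sum>l\<in>{0..<k}. 1 / (real k - real l)\<^sup>2) = (\<Sum>j=1..k. 1 / (real j)\<^sup>2)"
    by (rule sum.reindex_bij_witness[of _ "\<lambda>j. k - j" "\<lambda>l. k - l"]) (auto simp: of_nat_diff)
  also have "(\<Sum>l\<in>{k<..m}. 1 / (real k - real l)\<^sup>2) = (\<Sum>j=1..m - k. 1 / (real j)\<^sup>2)"
    by (rule sum.reindex_bij_witness[of _ "\<lambda>j. k + j" "\<lambda>l. l - k"])
       (auto simp: of_nat_diff power2_commute[of "real k"])
  finally show ?thesis using two[of k] two[of "m - k"] by linarith
qed

text \<open>
  For \<open>k, l \<le> n/2\<close> the gap is of order \<open>(k - l)\<^sup>2 / n\<^sup>2\<close>, so the sum converges like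
  \<open>n\<^sup>2 \<Sum>j. 1 / j\<^sup>2\<close>, without a logarithm.
\<close>

lemma sum_inverse_gaps_le:
  assumes n: "n > 0" and \<mu>: "\<mu> \<in> spectrum n"
  shows "(\<Sum>\<nu>\<in>spectrum n - {\<mu>}. 1 / cmod (\<mu> - \<nu>)) \<le> 18 * (real n)\<^sup>2"
proof -
  define ev where "ev = (\<lambda>(\<sigma>, k). eigval \<sigma> (2 * pi * real k / real n))"
  have "\<mu> \<in> ev ` ({1, - 1} \<times> {0..n div 2})"
    using \<mu> by (simp only: spectrum_def ev_def)
  then obtain \<sigma> k where \<sigma>: "\<sigma> \<in> {1, - 1}" and k: "k \<le> n div 2" and \<mu>_eq: "\<mu> = ev (\<sigma>, k)"
    by (elim imageE SigmaE) auto
  \<comment> \<open>At \<open>l = k\<close> only the opposite branch remains, and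
    \<open>eigval_conj_gap\<close> bounds its inverse gap by 1.\<close>
  define bound where "bound l = (if l = k then 1 else 2 * (real n)\<^sup>2 * (1 / (real k - real l)\<^sup>2))" for l
  let ?P = "{1, - 1 :: real} \<times> {0..n div 2}"
  \<comment> \<open>Passing from eigenvalues to their labels can only enlarge a sum of nonnegative
    terms.\<close>
  have "(\<Sum>\<nu>\<in>spectrum n - {\<mu>}. 1 / cmod (\<mu> - \<nu>)) \<le> (\<Sum>\<nu>\<in>ev ` (?P - {(\<sigma>, k)}). 1 / cmod (\<mu> - \<nu>))"
    by (rule sum_mono2) (auto simp: spectrum_def ev_def[symmetric] \<mu>_eq)
  also have "\<dots> \<le> (\<Sum>p\<in>?P - {(\<sigma>, k)}. 1 / cmod (\<mu> - ev p))"
    using sum_image_le[of "?P - {(\<sigma>, k)}" "\<lambda>\<nu>. 1 / cmod (\<mu> - \<nu>)" ev] by simp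
  also have "\<dots> \<le> (\<Sum>p\<in>?P - {(\<sigma>, k)}. bound (snd p))"
  proof (rule sum_mono)
    fix p assume "p \<in> ?P - {(\<sigma>, k)}"
    then obtain \<sigma>' l where p_eq: "p = (\<sigma>', l)"
      and p: "\<sigma>' \<in> {1, - 1}" "l \<in> {0..n div 2}" "\<not> (\<sigma>' = \<sigma> \<and> l = k)"
      by (cases p) auto
    have "1 / cmod (\<mu> - ev (\<sigma>', l)) \<le> bound l"
    proof (cases "l = k")
      case True
      then have "\<sigma>' = - \<sigma>" using p \<sigma> by auto
      then show ?thesis
        using True eigval_conj_gap[OF \<sigma>, of "2 * pi * real k / real n"]
        by (auto simp: \<mu>_eq ev_def bound_def divide_le_eq_1)
    next
      case False
      then have pos: "(real k - real l)\<^sup>2 / (2 * (real n)\<^sup>2) > 0" using n by simp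
      have "1 / cmod (\<mu> - ev (\<sigma>', l)) \<le> 1 / ((real k - real l)\<^sup>2 / (2 * (real n)\<^sup>2))"
        using eigval_gap[OF k _ n, of l \<sigma> \<sigma>'] p
        by (intro frac_le[OF _ _ pos]) (simp_all add: \<mu>_eq ev_def)
      then show ?thesis using False by (simp add: bound_def)
    qed
    then show "1 / cmod (\<mu> - ev p) \<le> bound (snd p)" by (simp add: p_eq)
  qed
  also have "\<dots> \<le> (\<Sum>p\<in>?P. bound (snd p))"
    by (rule sum_mono2) (auto simp: bound_def)
  also have "\<dots> = 2 * (\<Sum>l\<in>{0..n div 2}. bound l)"
    by (simp add: sum.cartesian_product' )
  also have "(\<Sum>l\<in>{0..n div 2}. bound l) = 1 + (\<Sum>l\<in>{0..n div 2} - {k}. 2 * (real n)\<^sup>2 * (1 / (real k - real l)\<^sup>2))"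
    using k by (subst sum.remove[of _ k]) (auto simp: bound_def intro!: sum.cong)
  also have "\<dots> \<le> 1 + 2 * (real n)\<^sup>2 * 4"
    unfolding sum_distrib_left[symmetric]
    by (intro add_left_mono mult_left_mono sum_inverse_square_distances_le k) simp
  also have "2 * (1 + 2 * (real n)\<^sup>2 * 4) \<le> 18 * (real n)\<^sup>2"
    using one_le_power[of "real n" 2] n by simp
  finally show ?thesis by simp
qed

lemma mix_dist_hadamard_le:
  assumes n: "n > 0" and \<psi>: "\<psi> \<in> L2 (cycle_states n)" "L2_norm (cycle_states n) \<psi> = 1" and T: "T > 0"
  shows "mix_dist (cycle_states n) (hadamard_walk n) T \<psi> \<le> 36 * (real n)\<^sup>2 / T"
proof -
  obtain \<phi> where eig: "\<And>\<mu>. \<mu> \<in> spectrum n \<Longrightarrow> hadamard_walk n (\<phi> \<mu>) = (\<lambda>x. \<mu> * \<phi> \<mu> x)"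
    and \<psi>_eq: "\<psi> = (\<lambda>x. \<Sum>\<mu>\<in>spectrum n. \<phi> \<mu> x)"
    using eigen_sum_L2[OF n \<psi>(1)] unfolding eigen_sum_def by metis
  \<comment> \<open>The eigenvalues index themselves, so injectivity is immediate.\<close>
  interpret E: eigen_expansion "cycle_states n" "hadamard_walk n" "spectrum n" "\<lambda>\<mu>. \<mu>" \<phi>
    using n eig by unfold_locales (simp_all add: hadamard_walk_sum norm_spectrum)
  have "E.\<psi> = \<psi>" by (simp add: E.\<psi>_def \<psi>_eq)
  then show ?thesis
    using E.mix_dist_le[OF T hadamard_walk_isometry[OF n] sum_inverse_gaps_le[OF n]] \<psi>(2)
    by (simp add: L2_norm_def)
qed

lemma mixing_time_upper:
  assumes n: "n \<ge> 3" and \<epsilon>: "0 < \<epsilon>" "\<epsilon> < 1"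
  shows "mixing_time (cycle_states n) (hadamard_walk n) \<epsilon> \<le> ereal (37 / \<epsilon> * real n ^ 2 * ln (real n))"
proof -
  \<comment> \<open>Rounding up costs at most 1, which is at most
    \<open>n\<^sup>2 / \<epsilon>\<close>; hence 37 instead of 36.\<close>
  define N where "N = nat \<lceil>36 * (real n)\<^sup>2 / \<epsilon>\<rceil>"
  have pos: "36 * (real n)\<^sup>2 / \<epsilon> > 0" using n \<epsilon> by simp
  then have N: "N \<ge> 1" "36 * (real n)\<^sup>2 / \<epsilon> \<le> N" "real N \<le> 36 * (real n)\<^sup>2 / \<epsilon> + 1"
    unfolding N_def by linarith+
  have "mixing_time (cycle_states n) (hadamard_walk n) \<epsilon> \<le> ereal (real N)"
  proof (rule mixing_time_le[OF N(1)])
    fix \<psi> T assume \<psi>: "\<psi> \<in> L2 (cycle_states n)" "L2_norm (cycle_states n) \<psi> = 1" and T: "T \<ge> N"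
    have "36 * (real n)\<^sup>2 / \<epsilon> \<le> real T" using N(2) T by linarith
    then have "36 * (real n)\<^sup>2 / T \<le> \<epsilon>" using \<epsilon> N(1) T by (simp add: field_simps)
    then show "mix_dist (cycle_states n) (hadamard_walk n) T \<psi> \<le> \<epsilon>"
      using mix_dist_hadamard_le[OF _ \<psi>, of T] n N(1) T by simp
  qed
  also have "real N \<le> 37 / \<epsilon> * real n ^ 2 * ln (real n)"
  proof -
    \<comment> \<open>From \<open>n = 3\<close> on the logarithm is at least 1, since
      \<open>exp 1\<close> is at most 3.\<close>
    have "exp 1 \<le> real n" using n by (intro order_trans[OF exp_le]) simp
    then have ln: "1 \<le> ln (real n)" using n by (subst ln_ge_iff) auto
    have "1 \<le> (real n)\<^sup>2" using one_le_power[of "real n" 2] n by simp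
    then have "1 \<le> (real n)\<^sup>2 / \<epsilon>" using \<epsilon> by simp
    moreover have "36 * (real n)\<^sup>2 / \<epsilon> = 36 * ((real n)\<^sup>2 / \<epsilon>)"
      "37 / \<epsilon> * (real n)\<^sup>2 * 1 = 37 * ((real n)\<^sup>2 / \<epsilon>)" by simp_all
    ultimately have "real N \<le> 37 / \<epsilon> * (real n)\<^sup>2 * 1" using N(3) by linarith
    also have "\<dots> \<le> 37 / \<epsilon> * (real n)\<^sup>2 * ln (real n)"
      using ln \<epsilon> by (intro mult_left_mono) auto
    finally show ?thesis .
  qed
  finally show ?thesis by simp
qed

section \<open>Wave packets and the lower bound\<close>

text \<open>The second entry solves the first row of the eigenvalue equation for the given first
  entry. That entry has modulus 1, so normalisation never divides by zero and stays
  continuous.\<close>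

definition coin_vec_raw :: "real \<Rightarrow> nat \<Rightarrow> complex" where
  "coin_vec_raw \<theta> s = (if s = 1 then cis \<theta> else of_real (sqrt 2) * eigval 1 \<theta> - cis (- \<theta>))"

definition coin_vec :: "real \<Rightarrow> nat \<Rightarrow> complex" where
  "coin_vec \<theta> s = coin_vec_raw \<theta> s / of_real (sqrt (1 + (cmod (coin_vec_raw \<theta> 2))\<^sup>2))"

lemma coin_step_scale: "coin_step \<theta> (\<lambda>s. w s / c) s = coin_step \<theta> w s / c"
  by (simp add: coin_step_def add_divide_distrib diff_divide_distrib mult.commute)

lemma coin_step_coin_vec:
  assumes "s \<in> {1, 2}"
  shows "coin_step \<theta> (coin_vec \<theta>) s = eigval 1 \<theta> * coin_vec \<theta> s"
proof -
  define a b r \<mu> where "a = cis \<theta>" and "b = cis (- \<theta>)" and "r = complex_of_real (sqrt 2)" and "\<mu> = eigval 1 \<theta>"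
  have r: "r * r = 2" "r \<noteq> 0" by (simp_all add: r_def flip: of_real_mult)
  have ab: "a * b = 1" by (simp add: a_def b_def cis_mult)
  have "a + b = 2 * of_real (cos \<theta>)" by (simp add: a_def b_def complex_eq_iff)
  then have "r * (a + b) = 2 * of_real (sqrt 2 * cos \<theta>)" by (simp add: r_def)
  then have \<mu>: "2 * (\<mu> * \<mu>) = r * (a + b) * \<mu> - 2"
    using eigval_square[of 1 \<theta>] by (simp add: \<mu>_def power2_eq_square)
  have 1: "(b * a + a * (r * \<mu> - b)) / r = \<mu> * a"
    using r by (simp add: field_simps)
  \<comment> \<open>The second row is where the characteristic equation enters.\<close>
  have "r * ((- (b * a) + a * (r * \<mu> - b)) / r) = r * a * \<mu> - 2 * (a * b)"
    using r(2) by simp (simp add: algebra_simps)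
  also have "\<dots> = r * a * \<mu> - 2" by (simp add: ab)
  also have "\<dots> = 2 * (\<mu> * \<mu>) - r * b * \<mu>" unfolding \<mu> by (simp add: algebra_simps)
  also have "\<dots> = (r * r) * (\<mu> * \<mu>) - r * b * \<mu>" by (simp only: r(1))
  also have "\<dots> = r * (\<mu> * (r * \<mu> - b))" by (simp add: algebra_simps)
  finally have 2: "(- (b * a) + a * (r * \<mu> - b)) / r = \<mu> * (r * \<mu> - b)"
    by (simp only: mult_left_cancel[OF r(2)])
  have "coin_step \<theta> (coin_vec_raw \<theta>) s = \<mu> * coin_vec_raw \<theta> s"
    using assms 1 2 unfolding coin_step_def coin_vec_raw_def a_def b_def r_def \<mu>_def by auto
  then show ?thesis
    unfolding coin_vec_def coin_step_scale by (simp add: \<mu>_def)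
qed

lemma coin_vec_unit: "(cmod (coin_vec \<theta> 1))\<^sup>2 + (cmod (coin_vec \<theta> 2))\<^sup>2 = 1"
proof -
  define q where "q = 1 + (cmod (coin_vec_raw \<theta> 2))\<^sup>2"
  have "q > 0" by (simp add: q_def add_pos_nonneg)
  have "cmod (coin_vec_raw \<theta> 1) = 1" by (simp add: coin_vec_raw_def)
  then have "(cmod (coin_vec \<theta> 1))\<^sup>2 + (cmod (coin_vec \<theta> 2))\<^sup>2 = 1 / q + (cmod (coin_vec_raw \<theta> 2))\<^sup>2 / q"
    using \<open>q > 0\<close> by (simp add: coin_vec_def norm_divide power_divide q_def[symmetric])
  also have "\<dots> = 1" using \<open>q > 0\<close> by (simp add: q_def flip: add_divide_distrib)
  finally show ?thesis .
qed

lemma coin_vec_0: "coin_vec 0 1 = 1 / of_real (sqrt 2)" "coin_vec 0 2 = \<i> / of_real (sqrt 2)"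
proof -
  have "coin_vec_raw 0 2 = \<i>"
    by (simp add: coin_vec_raw_def eigval_def complex_eq_iff real_sqrt_divide)
  moreover have "coin_vec_raw 0 1 = 1" by (simp add: coin_vec_raw_def)
  ultimately show "coin_vec 0 1 = 1 / of_real (sqrt 2)" "coin_vec 0 2 = \<i> / of_real (sqrt 2)"
    by (simp_all add: coin_vec_def)
qed

lemma isCont_coin_vec: "isCont (\<lambda>\<theta>. coin_vec \<theta> s) x"
proof -
  have raw: "continuous_on UNIV (\<lambda>\<theta>. coin_vec_raw \<theta> s)" for s
    unfolding coin_vec_raw_def eigval_def Complex_eq by (cases "s = 1") (auto intro!: continuous_intros)
  have "sqrt (1 + (cmod (coin_vec_raw \<theta> 2))\<^sup>2) \<noteq> 0" for \<theta>
    using add_pos_nonneg[of 1 "(cmod (coin_vec_raw \<theta> 2))\<^sup>2"] by simp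
  then have "continuous_on UNIV (\<lambda>\<theta>. coin_vec \<theta> s)"
    unfolding coin_vec_def by (intro continuous_intros raw) simp_all
  then show ?thesis by (simp add: continuous_on_eq_continuous_at)
qed

text \<open>The coin factor of the inner product of two modes, weighted by a test function
  \<open>u\<close> of the label.\<close>

definition overlap :: "(nat \<Rightarrow> complex) \<Rightarrow> real \<Rightarrow> real \<Rightarrow> complex" where
  "overlap u \<theta> \<theta>' = (\<Sum>s\<in>{1, 2}. u s * coin_vec \<theta> s * cnj (coin_vec \<theta>' s))"

text \<open>Fixed frequencies have angles tending to 0, so by continuity both coin vectors approach
  the same unit vector.\<close>

lemma overlap_tendsto:
  "(\<lambda>n. overlap (\<lambda>_. 1) (2 * pi * real k / real n) (2 * pi * real l / real n)) \<longlonglongrightarrow> 1"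
proof -
  have angle: "(\<lambda>n. 2 * pi * real k / real n) \<longlonglongrightarrow> 0" for k
    by (rule lim_const_over_n)
  have vec: "(\<lambda>n. coin_vec (2 * pi * real k / real n) s) \<longlonglongrightarrow> coin_vec 0 s" for k s
    by (rule isCont_tendsto_compose[OF isCont_coin_vec angle])
  have "(\<lambda>n. overlap (\<lambda>_. 1) (2 * pi * real k / real n) (2 * pi * real l / real n)) \<longlonglongrightarrow>
      (\<Sum>s\<in>{1, 2}. 1 * coin_vec 0 s * cnj (coin_vec 0 s))"
    unfolding overlap_def by (intro tendsto_intros vec)
  also have "(\<Sum>s\<in>{1, 2}. 1 * coin_vec 0 s * cnj (coin_vec 0 s)) = 1"
    using coin_vec_0 by (simp flip: of_real_mult)
  finally show ?thesis .
qed

section \<open>Equal superpositions of low modes\<close>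

text \<open>The packet uses frequencies below \<open>m\<close> on the branch with positive imaginary
  part. Staying within half the cycle keeps their eigenvalues distinct.\<close>

locale wave_packet =
  fixes n m :: nat
  assumes n: "n > 0" and m: "m > 0" "m - 1 \<le> n div 2"
begin

definition angle :: "nat \<Rightarrow> real" where
  "angle k = 2 * pi * real k / real n"

text \<open>The factor gives every mode squared norm \<open>1 / m\<close>, so the packet is a unit
  vector.\<close>

definition mode :: "nat \<Rightarrow> int \<times> nat \<Rightarrow> complex" where
  "mode k = plane_wave n (int k) (\<lambda>s. coin_vec (angle k) s / of_real (sqrt (real m * real n)))"

sublocale eigen_expansion "cycle_states n" "hadamard_walk n" "{..<m}" "\<lambda>k. eigval 1 (angle k)" mode
proof unfold_locales
  show "hadamard_walk n (mode k) = (\<lambda>x. eigval 1 (angle k) * mode k x)" for k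
    unfolding mode_def
  proof (rule hadamard_walk_plane_wave_eigen[OF n])
    fix s :: nat assume s: "s \<in> {1, 2}"
    show "coin_step (2 * pi * real_of_int (int k) / real n)
        (\<lambda>s. coin_vec (angle k) s / of_real (sqrt (real m * real n))) s =
        eigval 1 (angle k) * (coin_vec (angle k) s / of_real (sqrt (real m * real n)))"
      using coin_step_coin_vec[OF s, of "angle k"]
      unfolding coin_step_scale by (simp add: angle_def)
  qed
  show "inj_on (\<lambda>k. eigval 1 (angle k)) {..<m}"
  proof (rule inj_onI, rule ccontr)
    fix k l assume *: "k \<in> {..<m}" "l \<in> {..<m}" "eigval 1 (angle k) = eigval 1 (angle l)" "k \<noteq> l"
    then have "(real k - real l)\<^sup>2 / (2 * (real n)\<^sup>2) \<le> 0"
      using eigval_gap[of k n l 1 1] m n by (simp add: angle_def)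
    moreover have "(real k - real l)\<^sup>2 / (2 * (real n)\<^sup>2) > 0" using *(4) n by simp
    ultimately show False by simp
  qed
qed (simp_all add: hadamard_walk_sum n norm_eigval)

text \<open>For a test function that is a product, position and coin separate into a character sum
  and an overlap.\<close>

lemma sum_mode_product:
  "(\<Sum>x\<in>cycle_states n. g (fst x) * u (snd x) * mode k x * cnj (mode l x)) =
     (\<Sum>v\<in>{0..<int n}. g v * wave n (int k - int l) v) / of_nat (m * n) * overlap u (angle k) (angle l)"
proof -
  have s: "complex_of_real (sqrt (real m * real n)) * of_real (sqrt (real m * real n)) = of_nat (m * n)"
    by (simp flip: of_real_mult) simp
  have "g v * u s * mode k (v, s) * cnj (mode l (v, s)) =
      g v * wave n (int k - int l) v / of_nat (m * n) * (u s * coin_vec (angle k) s * cnj (coin_vec (angle l) s))"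
    if "v \<in> {0..<int n}" "s \<in> {1, 2}" for v s
    using that wave_add[of n "int k" "- int l" v] s[symmetric]
    by (simp add: mode_def plane_wave_def cycle_states_def cnj_wave mult_ac)
  then have "(\<Sum>x\<in>cycle_states n. g (fst x) * u (snd x) * mode k x * cnj (mode l x)) =
      (\<Sum>v\<in>{0..<int n}. g v * wave n (int k - int l) v / of_nat (m * n) * overlap u (angle k) (angle l))"
    unfolding sum_cycle_states overlap_def by (intro sum.cong) (simp_all add: distrib_left)
  then show ?thesis by (simp add: sum_distrib_right sum_divide_distrib)
qed

lemma packet_L2: "\<psi> \<in> L2 (cycle_states n)"
  by (simp add: L2_def \<psi>_def mode_def plane_wave_def)

lemma packet_norm: "L2_norm (cycle_states n) \<psi> = 1"
proof -
  have "(\<Sum>x\<in>cycle_states n. (cmod (mode k x))\<^sup>2) = 1 / real m" for k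
  proof -
    have "(cmod (mode k (v, 1)))\<^sup>2 + (cmod (mode k (v, 2)))\<^sup>2 = 1 / (real m * real n)"
      if "v \<in> {0..<int n}" for v
    proof -
      have "(cmod (mode k (v, s)))\<^sup>2 = (cmod (coin_vec (angle k) s))\<^sup>2 / (real m * real n)" if "s \<in> {1, 2}" for s
        using that \<open>v \<in> _\<close>
        by (simp add: mode_def plane_wave_def cycle_states_def norm_mult norm_divide power_divide)
      then show ?thesis
        using coin_vec_unit[of "angle k"] by (simp flip: add_divide_distrib)
    qed
    then show ?thesis using n by (simp add: sum_cycle_states)
  qed
  then show ?thesis
    using sum_norms_eq[OF hadamard_walk_isometry[OF n]] m by (simp add: L2_norm_def)
qed

lemma packet_test_le:
  assumes "T > 0" "\<And>v. cmod (g v) \<le> 1" "\<And>s. cmod (u s) \<le> 1"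
  shows "cmod (\<Sum>k<m. \<Sum>l\<in>{..<m} - {k}. (\<Sum>v\<in>{0..<int n}. g v * wave n (int k - int l) v) / of_nat (m * n) *
     overlap u (angle k) (angle l) * power_mean T (eigval 1 (angle k) * cnj (eigval 1 (angle l))))
     \<le> mix_dist (cycle_states n) (hadamard_walk n) T \<psi>"
proof -
  have "cmod (g (fst x) * u (snd x)) \<le> 1" for x :: "int \<times> nat"
    using assms(2,3) by (simp add: norm_mult mult_le_one)
  from test_le_mix_dist[OF assms(1), of "\<lambda>x. g (fst x) * u (snd x)", OF this] show ?thesis
    by (simp only: sum_mode_product)
qed

end

section \<open>Small accuracy: two beating modes\<close>

text \<open>Guards against times at which the beat happens to vanish. If about
  \<open>2 / cmod (1 - z)\<close> powers all stayed within distance 1 of 1, their real parts would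
  exceed 1/2 and the geometric sum would be too large.\<close>

lemma exists_power_far_from_one:
  assumes z: "cmod z = 1" "z \<noteq> 1"
  shows "\<exists>T\<ge>N. real T \<le> real N + 2 / cmod (1 - z) + 1 \<and> cmod (1 - z ^ T) \<ge> 1 / 2"
proof -
  define h where "h = cmod (1 - z)"
  define p where "p = nat \<lceil>2 / h\<rceil>"
  have h: "h > 0" using z by (simp add: h_def)
  have p: "2 / h \<le> real p" "real p \<le> 2 / h + 1"
    using h of_int_ceiling_le_add_one[of "2 / h"] le_of_int_ceiling[of "2 / h"] by (simp_all add: p_def)
  have "\<exists>j\<le>p. cmod (1 - z ^ j) \<ge> 1"
  proof (rule ccontr)
    assume "\<not> ?thesis"
    then have small: "cmod (1 - z ^ j) < 1" if "j \<le> p" for j using that by force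
    have half: "Re (z ^ j) \<ge> 1 / 2" if "j \<le> p" for j
    proof -
      have "(cmod (1 - z ^ j))\<^sup>2 < 1" using small[OF that] by (simp add: power_less_one_iff abs_square_less_1)
      then have "(1 - Re (z ^ j))\<^sup>2 + (Im (z ^ j))\<^sup>2 < 1" unfolding cmod_power2 by simp
      moreover have "(Re (z ^ j))\<^sup>2 + (Im (z ^ j))\<^sup>2 = 1"
        using z by (simp flip: cmod_power2 add: norm_power)
      ultimately show ?thesis by (simp add: power2_eq_square algebra_simps)
    qed
    have "real p / 2 = (\<Sum>j<p. 1 / 2)" by simp
    also have "\<dots> \<le> (\<Sum>j<p. Re (z ^ j))" using half by (intro sum_mono) auto
    also have "\<dots> = Re (\<Sum>j<p. z ^ j)" by simp
    also have "\<dots> \<le> cmod (\<Sum>j<p. z ^ j)" by (rule complex_Re_le_cmod)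
    finally have "h * (real p / 2) \<le> h * cmod (\<Sum>j<p. z ^ j)" using h by (intro mult_left_mono) auto
    also have "\<dots> = cmod (1 - z ^ p)"
      unfolding h_def norm_mult[symmetric] by (simp add: one_diff_power_eq)
    finally have "h * (real p / 2) < 1" using small[of p] by simp
    moreover have "1 \<le> h * (real p / 2)" using p(1) h by (simp add: field_simps)
    ultimately show False by simp
  qed
  then obtain j where j: "j \<le> p" "cmod (1 - z ^ j) \<ge> 1" by blast
  show ?thesis
  proof (cases "cmod (1 - z ^ N) \<ge> 1 / 2")
    case True
    then show ?thesis using h by (intro exI[of _ N]) (auto simp: h_def)
  next
    case False
    \<comment> \<open>If \<open>z ^ N\<close> is close to 1, a further \<open>j\<close> steps move
      it away, by the triangle inequality.\<close>
    have "cmod (z ^ N * (1 - z ^ j)) \<le> cmod (1 - z ^ (N + j)) + cmod (1 - z ^ N)"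
      using norm_triangle_ineq4[of "1 - z ^ (N + j)" "1 - z ^ N"] by (simp add: power_add algebra_simps)
    then have "cmod (1 - z ^ (N + j)) \<ge> 1 / 2"
      using False j(2) z(1) by (simp add: norm_mult norm_power)
    then show ?thesis using j(1) p(2) by (intro exI[of _ "N + j"]) (auto simp: h_def)
  qed
qed

lemma mixing_time_lower_small:
  assumes n: "n \<ge> 3" and \<epsilon>: "0 < \<epsilon>" "\<epsilon> \<le> 1 / 100"
  shows "ereal (1 / 1024 / \<epsilon> * real n ^ 2) \<le> mixing_time (cycle_states n) (hadamard_walk n) \<epsilon>"
proof -
  interpret P: wave_packet n 2 using n by unfold_locales auto
  define z where "z = eigval 1 (P.angle 0) * cnj (eigval 1 (P.angle 1))"
  define h where "h = cmod (1 - z)"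
  have z: "cmod z = 1" "z \<noteq> 1"
    using P.ratio_norm[of 0 1] P.ratio_neq_one[of 0 1] by (simp_all add: z_def)
  have h: "h > 0" using z by (simp add: h_def)
  have "h \<le> 64 / (real n)\<^sup>2"
    using P.one_minus_ratio_norm[of 0 1] eigval_close[of n 0 1 1] n by (simp add: h_def z_def P.angle_def)
  then have hn: "h * (real n)\<^sup>2 \<le> 64" using n by (simp add: field_simps)
  have h2: "h \<le> 2" using norm_triangle_ineq4[of 1 z] z by (simp add: h_def)
  \<comment> \<open>Since \<open>h * n\<^sup>2\<close> is at most 64, this choice gives
    \<open>\<epsilon> * (h * T)\<close> at most \<open>1 / 16 + 6 * \<epsilon>\<close>, which is
    below 1/8 for \<epsilon> up to 1/100.\<close>
  define N where "N = nat \<lceil>1 / 1024 / \<epsilon> * (real n)\<^sup>2\<rceil>"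
  have "1 / 1024 / \<epsilon> * (real n)\<^sup>2 > 0" using n \<epsilon> by simp
  then have N: "N > 0" "1 / 1024 / \<epsilon> * (real n)\<^sup>2 \<le> N" "real N \<le> 1 / 1024 / \<epsilon> * (real n)\<^sup>2 + 1"
    unfolding N_def by linarith+
  obtain T where T: "T \<ge> N" "real T \<le> real N + 2 / h + 1" "cmod (1 - z ^ T) \<ge> 1 / 2"
    using exists_power_far_from_one[OF z, of N] unfolding h_def by blast
  have "T > 0" using T N by simp
  \<comment> \<open>The test function cancels the phases, so the two coin terms cannot cancel each
    other.\<close>
  define u where "u s = cnj (sgn (coin_vec (P.angle 0) s * cnj (coin_vec (P.angle 1) s)))" for s
  define a b where "a = cmod (coin_vec (P.angle 1) 1)" and "b = cmod (coin_vec (P.angle 1) 2)"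
  have u: "u s * coin_vec (P.angle 0) s * cnj (coin_vec (P.angle 1) s) =
      of_real (cmod (coin_vec (P.angle 0) s) * cmod (coin_vec (P.angle 1) s))" for s
  proof -
    have "cnj (sgn y) * y = of_real (cmod y)" for y :: complex
    proof (cases "y = 0")
      case False
      have "cnj (sgn y) * y = of_real ((cmod y)\<^sup>2) / of_real (cmod y)"
        unfolding complex_norm_square by (simp add: sgn_eq mult.commute)
      then show ?thesis using False by (simp add: power2_eq_square)
    qed simp
    then show ?thesis unfolding u_def by (metis mult.assoc norm_mult complex_mod_cnj)
  qed
  have "overlap u (P.angle 0) (P.angle 1) = of_real ((a + b) / sqrt 2)"
    using coin_vec_0 unfolding overlap_def u
    by (simp add: P.angle_def a_def b_def norm_divide add_divide_distrib)
  moreover have "1 / 2 \<le> (a + b) / sqrt 2"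
  proof -
    have "1\<^sup>2 \<le> (a + b)\<^sup>2"
      using coin_vec_unit[of "P.angle 1"] by (simp add: a_def b_def power2_sum)
    then have "1 \<le> a + b" by (rule power2_le_imp_le) (simp add: a_def b_def)
    moreover have "sqrt 2 \<le> 2" by (rule real_le_lsqrt) auto
    ultimately show ?thesis by (simp add: field_simps)
  qed
  ultimately have overlap: "cmod (overlap u (P.angle 0) (P.angle 1)) \<ge> 1 / 2"
    by (simp only: norm_of_real)
  have pm: "cmod (power_mean T z) \<ge> 1 / 2 / (h * T)"
    unfolding power_mean_eq[OF z(2)] norm_divide norm_mult h_def[symmetric] norm_of_nat
    using T(3) h by (intro divide_right_mono) auto
  \<comment> \<open>Testing against the first character keeps one off-diagonal term; the other has
    frequency 2, which vanishes for \<open>n\<close> at least 3.\<close>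
  have "\<not> int n dvd 2" using n by (auto dest: zdvd_imp_le)
  then have sums: "(\<Sum>v\<in>{0..<int n}. wave n 1 v * wave n (int 0 - int 1) v) = of_nat n"
    "(\<Sum>v\<in>{0..<int n}. wave n 1 v * wave n (int 1 - int 0) v) = 0"
    using n sum_wave[of n 0] sum_wave[of n 2] by (simp_all flip: wave_add)
  have u_le: "cmod (u s) \<le> 1" for s by (simp add: u_def norm_sgn)
  have pairs: "(\<Sum>k<2. \<Sum>l\<in>{..<2} - {k}. F k l) = F 0 1 + F 1 0" for F :: "nat \<Rightarrow> nat \<Rightarrow> complex"
  proof -
    have "{..<2} - {0} = {1::nat}" "{..<2} - {1} = {0::nat}" by auto
    then show ?thesis by (simp add: numeral_2_eq_2)
  qed
  have "cmod (of_nat n / of_nat (2 * n) * overlap u (P.angle 0) (P.angle 1) * power_mean T z)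
      \<le> mix_dist (cycle_states n) (hadamard_walk n) T P.\<psi>"
    using P.packet_test_le[of T "wave n 1" u, OF \<open>T > 0\<close> _ u_le] n sums unfolding pairs z_def by simp
  then have "1 / 2 * cmod (overlap u (P.angle 0) (P.angle 1)) * cmod (power_mean T z)
      \<le> mix_dist (cycle_states n) (hadamard_walk n) T P.\<psi>"
    using n by (simp add: norm_mult norm_divide)
  moreover have "1 / 2 * (1 / 2) * (1 / 2 / (h * T)) \<le> 1 / 2 * cmod (overlap u (P.angle 0) (P.angle 1)) * cmod (power_mean T z)"
    using overlap pm h by (intro mult_mono) auto
  \<comment> \<open>The factors are the mode weight, the overlap, and the power mean with numerator
    at least 1/2.\<close>
  moreover have "\<epsilon> < 1 / 2 * (1 / 2) * (1 / 2 / (h * T))"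
  proof -
    have "h * T \<le> h * (1 / 1024 / \<epsilon> * (real n)\<^sup>2 + 2 + 2 / h)"
      using T(2) N(3) h by (intro mult_left_mono) auto
    also have "\<dots> = h * (real n)\<^sup>2 / 1024 / \<epsilon> + 2 * h + 2"
      using h by (simp add: field_simps)
    also have "\<dots> \<le> 64 / 1024 / \<epsilon> + 6"
    proof -
      have "h * (real n)\<^sup>2 / 1024 / \<epsilon> \<le> 64 / 1024 / \<epsilon>"
        using hn \<epsilon> by (intro divide_right_mono) auto
      then show ?thesis using h2 by linarith
    qed
    finally have "\<epsilon> * (h * T) \<le> \<epsilon> * (64 / 1024 / \<epsilon> + 6)" using \<epsilon> by (intro mult_left_mono) auto
    also have "\<dots> = 1 / 16 + 6 * \<epsilon>" using \<epsilon> by (simp add: field_simps)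
    also have "\<dots> < 1 / 8" using \<epsilon> by simp
    finally show ?thesis using h \<open>T > 0\<close> by (simp add: field_simps)
  qed
  ultimately have "mix_dist (cycle_states n) (hadamard_walk n) T P.\<psi> > \<epsilon>" by linarith
  from mixing_time_ge[OF P.packet_L2 P.packet_norm this]
  have "ereal (real T) \<le> mixing_time (cycle_states n) (hadamard_walk n) \<epsilon>" .
  moreover have "1 / 1024 / \<epsilon> * real n ^ 2 \<le> real T" using N(2) T(1) by linarith
  ultimately show ?thesis by (meson ereal_less_eq(3) order_trans)
qed

section \<open>Larger accuracy: a packet that stays concentrated\<close>

text \<open>A trigonometric polynomial with values in [-1, 1] and peak at 0, where the packet
  starts. Its degree 2 couples only modes at distance at most 2.\<close>

definition bump :: "nat \<Rightarrow> int \<Rightarrow> complex" where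
  "bump n v = of_real ((1 + cos (2 * pi * real_of_int v / real n))\<^sup>2 / 2 - 1)"

lemma norm_bump_le: "cmod (bump n v) \<le> 1"
proof -
  define c where "c = cos (2 * pi * real_of_int v / real n)"
  have "0 \<le> 1 + c" "1 + c \<le> 2"
    using cos_ge_minus_one[of "2 * pi * real_of_int v / real n"] cos_le_one[of "2 * pi * real_of_int v / real n"]
    unfolding c_def by linarith+
  then have "(1 + c)\<^sup>2 \<le> 2\<^sup>2" by (intro power_mono) auto
  then have "\<bar>(1 + c)\<^sup>2 / 2 - 1\<bar> \<le> 1" by (simp add: abs_le_iff)
  then show ?thesis unfolding bump_def c_def[symmetric] norm_of_real .
qed

lemma bump_eq_waves:
  "bump n v = - 1 / 4 + (wave n 1 v + wave n (- 1) v) / 2 + (wave n 2 v + wave n (- 2) v) / 8"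
proof -
  define t where "t = 2 * pi * real_of_int v / real n"
  have w: "wave n 1 v = cis t" "wave n (- 1) v = cis (- t)" "wave n 2 v = cis (2 * t)" "wave n (- 2) v = cis (- (2 * t))"
    by (simp_all add: wave_def t_def mult_ac)
  have "bump n v = of_real ((1 + cos t)\<^sup>2 / 2 - 1)" by (simp add: bump_def t_def)
  also have "(1 + cos t)\<^sup>2 / 2 - 1 = - 1 / 4 + cos t + cos (2 * t) / 4"
    unfolding cos_double_cos by (simp add: power2_eq_square field_simps)
  finally show ?thesis unfolding w by (simp add: complex_eq_iff)
qed

text \<open>Fourier coefficients of \<open>bump\<close> off the diagonal. The value at 0 is set to 0
  instead of the mean -1/4, because diagonal terms belong to the limit distribution.\<close>

definition bump_coeff :: "int \<Rightarrow> real" where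
  "bump_coeff d = (if \<bar>d\<bar> = 1 then 1 / 2 else if \<bar>d\<bar> = 2 then 1 / 8 else 0)"

text \<open>The frequencies involved are at most 9 in absolute value, so \<open>n\<close> at least
  10 excludes aliasing.\<close>

lemma sum_bump_wave:
  assumes "\<bar>d\<bar> \<le> 7" "d \<noteq> 0" "n \<ge> 10"
  shows "(\<Sum>v\<in>{0..<int n}. bump n v * wave n d v) = of_nat n * of_real (bump_coeff d)"
proof -
  have dvd: "int n dvd e \<longleftrightarrow> e = 0" if "\<bar>e\<bar> \<le> 9" for e
    using that assms(3) dvd_imp_le_int[of e "int n"] by auto
  have "(\<Sum>v\<in>{0..<int n}. bump n v * wave n d v) = - 1 / 4 * (\<Sum>v\<in>{0..<int n}. wave n d v) +
     ((\<Sum>v\<in>{0..<int n}. wave n (1 + d) v) + (\<Sum>v\<in>{0..<int n}. wave n (- 1 + d) v)) / 2 +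
     ((\<Sum>v\<in>{0..<int n}. wave n (2 + d) v) + (\<Sum>v\<in>{0..<int n}. wave n (- 2 + d) v)) / 8"
    unfolding bump_eq_waves wave_add distrib_right sum.distrib
    by (simp add: sum_distrib_left sum_divide_distrib distrib_right sum.distrib add_divide_distrib)
  also have "\<dots> = of_nat n * of_real (bump_coeff d)"
    using assms dvd[of d] dvd[of "1 + d"] dvd[of "- 1 + d"] dvd[of "2 + d"] dvd[of "- 2 + d"]
    by (auto simp: sum_wave bump_coeff_def)
  finally show ?thesis .
qed

text \<open>There are 14 ordered pairs at distance 1 with weight 1/2 and 12 at distance 2 with
  weight 1/8.\<close>

lemma sum_bump_coeff:
  "(\<Sum>k<8. \<Sum>l\<in>{..<8} - {k}. bump_coeff (int k - int l)) = 17 / 2"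
proof -
  have "(\<Sum>l\<in>{..<8} - {k}. bump_coeff (int k - int l)) = (\<Sum>l<8. bump_coeff (int k - int l))" for k :: nat
    by (rule sum.mono_neutral_left) (auto simp: bump_coeff_def)
  then show ?thesis by (simp add: lessThan_Suc eval_nat_numeral bump_coeff_def)
qed

text \<open>
  Eight modes are enough for the packet to differ from its (uniform) limit by more than \<open>1\<close>:
  at time zero the test against the bump gives \<open>17 / 16\<close>.
\<close>

lemma mixing_time_lower_large:
  "\<exists>N\<ge>3. \<forall>n\<ge>N. \<forall>\<epsilon><1. ereal (real n ^ 2 / 401408) \<le> mixing_time (cycle_states n) (hadamard_walk n) \<epsilon>"
proof -
  \<comment> \<open>Only finitely many pairs occur, so one threshold serves all overlaps.\<close>
  have "\<forall>\<^sub>F n in sequentially. \<forall>k\<in>{..<8}. \<forall>l\<in>{..<8}.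
      dist (overlap (\<lambda>_. 1) (2 * pi * real k / real n) (2 * pi * real l / real n)) 1 < 1 / 64"
    by (intro eventually_ball_finite ballI tendstoD overlap_tendsto) auto
  then obtain M where M: "\<And>n k l. n \<ge> M \<Longrightarrow> k < 8 \<Longrightarrow> l < 8 \<Longrightarrow>
      cmod (overlap (\<lambda>_. 1) (2 * pi * real k / real n) (2 * pi * real l / real n) - 1) < 1 / 64"
    unfolding eventually_sequentially dist_norm by blast
  show ?thesis
  proof (intro exI[of _ "max M 1000"] conjI allI impI)
    fix n :: nat and \<epsilon> :: real
    assume "max M 1000 \<le> n" and \<epsilon>: "\<epsilon> < 1"
    then have n: "M \<le> n" "1000 \<le> n" by auto
    interpret P: wave_packet n 8 using n by unfold_locales auto
    have "(1000::real)\<^sup>2 \<le> (real n)\<^sup>2" using n by (intro power_mono) auto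
    then have n2: "1000000 \<le> (real n)\<^sup>2" by simp
    \<comment> \<open>Here 200704 is 64 times the constant \<open>64 * 7\<^sup>2\<close> of
      \<open>eigval_close\<close>, making \<open>T * cmod (1 - z k l)\<close> at most 1/64. Rounding
      down loses at most a factor 2.\<close>
    define T where "T = nat \<lfloor>(real n)\<^sup>2 / 200704\<rfloor>"
    have T: "real T \<le> (real n)\<^sup>2 / 200704" "real T \<ge> (real n)\<^sup>2 / 401408" "T > 0"
      using n2 unfolding T_def by linarith+
    define z where "z k l = eigval 1 (P.angle k) * cnj (eigval 1 (P.angle l))" for k l
    define w where "w k l = overlap (\<lambda>_. 1) (P.angle k) (P.angle l) * power_mean T (z k l)" for k l
    have w: "Re (w k l) \<ge> 31 / 32" if kl: "k < 8" "l < 8" for k l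
    proof -
      have norm: "cmod (z k l) = 1" using P.ratio_norm kl by (simp add: z_def)
      have "cmod (1 - z k l) \<le> 64 * 7\<^sup>2 / (real n)\<^sup>2"
        using P.one_minus_ratio_norm[of k l] eigval_close[of n k 7 l] kl n by (simp add: z_def P.angle_def)
      then have "real T * cmod (1 - z k l) \<le> (real n)\<^sup>2 / 200704 * (64 * 7\<^sup>2 / (real n)\<^sup>2)"
        using T(1) by (intro mult_mono) auto
      also have "\<dots> = 1 / 64" using n by simp
      finally have pm: "cmod (power_mean T (z k l) - 1) \<le> 1 / 64"
        using norm_power_mean_minus_one_le[OF norm T(3)] by simp
      \<comment> \<open>Overlap and power mean are each within 1/64 of 1, and the power mean has
        modulus at most 1.\<close>
      have "w k l - 1 = (overlap (\<lambda>_. 1) (P.angle k) (P.angle l) - 1) * power_mean T (z k l) + (power_mean T (z k l) - 1)"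
        by (simp add: w_def algebra_simps)
      then have "cmod (w k l - 1) \<le> cmod (overlap (\<lambda>_. 1) (P.angle k) (P.angle l) - 1) * cmod (power_mean T (z k l)) +
          cmod (power_mean T (z k l) - 1)"
        by (metis norm_mult norm_triangle_ineq)
      also have "\<dots> \<le> 1 / 64 * 1 + 1 / 64"
        using M[OF n(1) kl] norm_power_mean_le_one[OF norm] pm
        by (intro add_mono mult_mono) (auto simp: P.angle_def)
      finally have "cmod (w k l - 1) \<le> 1 / 32" by simp
      then show ?thesis using abs_Re_le_cmod[of "w k l - 1"] by simp
    qed
    \<comment> \<open>The left-hand side is 527/512, hence above every \<epsilon> below 1.\<close>
    have "17 / 2 / 8 * (31 / 32) = (\<Sum>k<8. \<Sum>l\<in>{..<8} - {k}. bump_coeff (int k - int l) / 8 * (31 / 32))"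
      by (simp add: sum_bump_coeff flip: sum_distrib_right sum_divide_distrib)
    also have "\<dots> \<le> (\<Sum>k<8. \<Sum>l\<in>{..<8} - {k}. bump_coeff (int k - int l) / 8 * Re (w k l))"
      by (intro sum_mono mult_left_mono w) (auto simp: bump_coeff_def)
    also have "\<dots> = Re (\<Sum>k<8. \<Sum>l\<in>{..<8} - {k}. of_real (bump_coeff (int k - int l) / 8) * w k l)"
      by simp
    also have "\<dots> \<le> cmod (\<Sum>k<8. \<Sum>l\<in>{..<8} - {k}. of_real (bump_coeff (int k - int l) / 8) * w k l)"
      by (rule complex_Re_le_cmod)
    also have "(\<Sum>k<8. \<Sum>l\<in>{..<8} - {k}. of_real (bump_coeff (int k - int l) / 8) * w k l) =
       (\<Sum>k<8. \<Sum>l\<in>{..<8} - {k}. (\<Sum>v\<in>{0..<int n}. bump n v * wave n (int k - int l) v) / of_nat (8 * n) *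
         overlap (\<lambda>_. 1) (P.angle k) (P.angle l) * power_mean T (z k l))"
      using n by (intro sum.cong refl, subst sum_bump_wave) (auto simp: w_def)
    also have "cmod \<dots> \<le> mix_dist (cycle_states n) (hadamard_walk n) T P.\<psi>"
      unfolding z_def by (rule P.packet_test_le[OF T(3) norm_bump_le]) simp
    finally have "mix_dist (cycle_states n) (hadamard_walk n) T P.\<psi> > \<epsilon>" using \<epsilon> by simp
    from mixing_time_ge[OF P.packet_L2 P.packet_norm this]
    have "ereal (real T) \<le> mixing_time (cycle_states n) (hadamard_walk n) \<epsilon>" .
    then show "ereal (real n ^ 2 / 401408) \<le> mixing_time (cycle_states n) (hadamard_walk n) \<epsilon>"
      using T(2) by (meson ereal_less_eq(3) order_trans)
  qed simp
qed

section \<open>Combining the regimes\<close>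

lemma mixing_time_cycle_ge_one:
  assumes "n > 0"
  shows "1 \<le> mixing_time (cycle_states n) (hadamard_walk n) \<epsilon>"
proof -
  interpret P: wave_packet n 1 using assms by unfold_locales auto
  show ?thesis by (rule mixing_time_ge_one[OF P.packet_L2 P.packet_norm])
qed

text \<open>Two modes settle \<epsilon> up to 1/100. Beyond that \<open>1 / \<epsilon>\<close> is
  below 100: the packet of eight modes settles long cycles, and the trivial bound 1 the remaining
  short ones.\<close>

lemma mixing_time_lower:
  "\<exists>c>0. \<forall>n\<ge>3. \<forall>\<epsilon>. 0 < \<epsilon> \<longrightarrow> \<epsilon> < 1 \<longrightarrow>
     ereal (c / \<epsilon> * real n ^ 2) \<le> mixing_time (cycle_states n) (hadamard_walk n) \<epsilon>"
proof -
  obtain N where N: "N \<ge> 3" and large: "\<And>n \<epsilon>. n \<ge> N \<Longrightarrow> \<epsilon> < 1 \<Longrightarrow>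
      ereal (real n ^ 2 / 401408) \<le> mixing_time (cycle_states n) (hadamard_walk n) \<epsilon>"
    using mixing_time_lower_large by blast
  \<comment> \<open>The first entry is 1/401408 divided by 100, for long cycles; the second makes
    the claimed bound at most 1 when \<open>n\<close> is below \<open>N\<close>.\<close>
  define c where "c = min (1 / 40140800) (1 / (100 * (real N)\<^sup>2))"
  have c: "c > 0" "c \<le> 1 / 1024" "100 * c \<le> 1 / 401408" "100 * c * (real N)\<^sup>2 \<le> 1"
    using N by (auto simp: c_def min_def field_simps)
  show ?thesis
  proof (intro exI[of _ c] conjI allI impI)
    fix n :: nat and \<epsilon> :: real
    assume n: "3 \<le> n" and \<epsilon>: "0 < \<epsilon>" "\<epsilon> < 1"
    let ?m = "mixing_time (cycle_states n) (hadamard_walk n) \<epsilon>"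
    show "ereal (c / \<epsilon> * real n ^ 2) \<le> ?m"
    proof (cases "\<epsilon> \<le> 1 / 100")
      case True
      have "c / \<epsilon> * real n ^ 2 \<le> 1 / 1024 / \<epsilon> * real n ^ 2"
        using c(2) \<epsilon> by (intro mult_right_mono divide_right_mono) auto
      then show ?thesis
        using mixing_time_lower_small[OF n \<epsilon>(1) True] by (meson ereal_less_eq(3) order_trans)
    next
      case False
      then have "c / \<epsilon> \<le> 100 * c" using c(1) \<epsilon> by (simp add: field_simps)
      then have le: "c / \<epsilon> * real n ^ 2 \<le> 100 * c * real n ^ 2" by (intro mult_right_mono) auto
      show ?thesis
      proof (cases "n \<ge> N")
        case True
        have "100 * c * real n ^ 2 \<le> 1 / 401408 * real n ^ 2" using c(3) by (intro mult_right_mono) auto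
        with le have "c / \<epsilon> * real n ^ 2 \<le> real n ^ 2 / 401408" by linarith
        then show ?thesis using large[OF True \<epsilon>(2)] by (meson ereal_less_eq(3) order_trans)
      next
        case False
        then have "100 * c * real n ^ 2 \<le> 100 * c * real N ^ 2"
          using c(1) by (intro mult_left_mono power_mono) auto
        with le c(4) have "c / \<epsilon> * real n ^ 2 \<le> 1" by linarith
        then have "ereal (c / \<epsilon> * real n ^ 2) \<le> 1" by (simp add: one_ereal_def)
        then show ?thesis using mixing_time_cycle_ge_one[of n \<epsilon>] n by (meson order_trans less_le_trans zero_less_numeral)
      qed
    qed
  qed (rule c(1))
qed

theorem proposition2p1:
  "\<exists>c1 c2 :: real. c1 > 0 \<and> c2 > 0 \<and>
     (\<forall>n::nat. \<forall>\<epsilon>::real. n \<ge> 3 \<longrightarrow> 0 < \<epsilon> \<longrightarrow> \<epsilon> < 1 \<longrightarrow>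
        ereal (c1 / \<epsilon> * real n ^ 2) \<le> mixing_time (cycle_states n) (hadamard_walk n) \<epsilon> \<and>
        mixing_time (cycle_states n) (hadamard_walk n) \<epsilon> \<le> ereal (c2 / \<epsilon> * real n ^ 2 * ln (real n)))"
proof -
  obtain c where "c > 0" "\<forall>n\<ge>3. \<forall>\<epsilon>. 0 < \<epsilon> \<longrightarrow> \<epsilon> < 1 \<longrightarrow>
     ereal (c / \<epsilon> * real n ^ 2) \<le> mixing_time (cycle_states n) (hadamard_walk n) \<epsilon>"
    using mixing_time_lower by blast
  then show ?thesis
    using mixing_time_upper by (intro exI[of _ c] exI[of _ 37]) auto
qed

end
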